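(* Suppose all $n$ agents' rankings of the $m$ alternatives are generated by the Mallows-type model with dispersion parameter $\theta$ and a ground-truth ranking. Then the estimate $\widehat{\texttt{cmp}}(\mathbf L)$ produced by \texttt{LDP-KwikSort:Lap} with overall privacy budget $\epsilon$ and $K$ queries per agent has error $<6\mu$ with probability at least $1-2^{-6\mu}$, where $$\mu=2\binom{m}{2}\exp\!\left(-\left(1-e^{-\frac{\epsilon}{2K}}\right)^2K\cdot\frac{{\theta^*}^2 n}{m(m-1)}\right),\qquad \theta^*=\frac{\theta}{2-\theta}.$$
   Context: Setting: alternatives $A=\{a_1,\dots,a_m\}$, agents $i=1,\dots,n$ each holding a ranking $L_i$ (a permutation of $A$), $\mathbf L=(L_1,\dots,L_n)$. Generative model: there is a ground-truth ranking; for each agent and each pair of alternatives, the agent's relative order of the pair agrees with the ground truth with probability $p_M\in[\tfrac12,1]$ and disagrees with probability $q_M=1-p_M$, and $\theta=1-q_M/p_M\in[0,1]$. Protocol \texttt{LDP-KwikSort:Lap}: let $\epsilon_k=\epsilon/K$. The curator sends each agent $K$ distinct pairwise queries ``do you prefer $a_j$ to $a_l$?'' ($j<l$) chosen at random among the $\binom m2$ pairs, so that each pair is queried to $n^*=nK/\binom m2$ agents; for each query the agent with true answer $o\in\{0,1\}$ ($1$ iff it prefers $a_j$ to $a_l$) reports $\widetilde o=o+X$ with $X$ an independent Laplace random variable of scale $1/\epsilon_k$. For each pair the curator sets $\widehat C_{a_ja_l}$ = number of reports with $\widetilde o\ge 0.5$ and $\widehat C_{a_la_j}$ = number of reports with $\widetilde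 o<0.5$, and $\widehat{\texttt{cmp}}_{\mathbf L}(a_j,a_l)=\widehat C_{a_ja_l}-\widehat C_{a_la_j}$; $\widehat{\texttt{cmp}}(\mathbf L)$ is the collection of these values, which is then fed to the KwikSort algorithm. The error of the estimate is the number of pairs of alternatives for which the sign of $\widehat{\texttt{cmp}}_{\mathbf L}(a_j,a_l)$ disagrees with the relative order of $a_j,a_l$ in the ground-truth ranking.
   Formalization: Agents are taken i.i.d., and the model, false for arbitrary dependence between pairs, is fixed as either pairs agreeing independently with probability p_M (answers may be intransitive) or the Mallows model, i.e. that draw conditioned on being a ranking (marginals then not exactly p_M). *)

theory Defs
  imports "HOL-Probability.Probability" "HOL-Combinatorics.Permutations"
begin

text \<open>
  Alternatives are the indices \<open>1, \<dots>, m\<close> and agents the indices \<open>1, \<dots>, n\<close>. A ranking is a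
  permutation \<open>\<tau>\<close> of \<open>{1..m}\<close>, where \<open>\<tau> j\<close> is the position of alternative \<open>j\<close>, so that
  \<open>\<tau> j < \<tau> l\<close> means that \<open>j\<close> is preferred to \<open>l\<close>.
\<close>

definition alt_pairs :: "nat \<Rightarrow> (nat \<times> nat) set" where
  "alt_pairs m = {(j, l). 1 \<le> j \<and> j < l \<and> l \<le> m}"

text \<open>
  An agent is represented by its answers to all queries ``do you prefer \<open>j\<close> to \<open>l\<close>?'' with
  \<open>j < l\<close>, extended by \<open>False\<close> outside \<open>alt_pairs m\<close>.
\<close>

definition answers_of :: "nat \<Rightarrow> (nat \<Rightarrow> nat) \<Rightarrow> nat \<times> nat \<Rightarrow> bool" where
  "answers_of m \<tau> = (\<lambda>(j, l). (j, l) \<in> alt_pairs m \<and> \<tau> j < \<tau> l)"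

definition ranking_answers :: "nat \<Rightarrow> (nat \<times> nat \<Rightarrow> bool) set" where
  "ranking_answers m = answers_of m ` {\<tau>. \<tau> permutes {1..m}}"

text \<open>
  Each pair is ordered as in the ground truth \<open>\<sigma>\<close> with probability \<open>p\<close>, independently of the
  other pairs. The outcome need not be transitive.
\<close>

definition pairwise_pmf :: "nat \<Rightarrow> real \<Rightarrow> (nat \<Rightarrow> nat) \<Rightarrow> (nat \<times> nat \<Rightarrow> bool) pmf" where
  "pairwise_pmf m p \<sigma> =
     Pi_pmf (alt_pairs m) False
       (\<lambda>(j, l). map_pmf (\<lambda>agree. if agree then \<sigma> j < \<sigma> l else \<not> \<sigma> j < \<sigma> l) (bernoulli_pmf p))"

text \<open>
  The Mallows model: the same pairwise orders, conditioned on forming a ranking. The ranking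
  \<open>\<tau>\<close> then has probability proportional to \<open>((1 - p) / p) ^ d\<close>, with \<open>d\<close> the Kendall tau
  distance between \<open>\<tau>\<close> and \<open>\<sigma>\<close>.
\<close>

definition mallows_pmf :: "nat \<Rightarrow> real \<Rightarrow> (nat \<Rightarrow> nat) \<Rightarrow> (nat \<times> nat \<Rightarrow> bool) pmf" where
  "mallows_pmf m p \<sigma> = cond_pmf (pairwise_pmf m p \<sigma>) (ranking_answers m)"

text \<open>
  \<open>A i\<close> is the set of pairs queried to agent \<open>i\<close>. The last condition makes
  \<open>n * K\<close> divisible by \<open>m choose 2\<close> whenever an assignment exists and \<open>2 \<le> m\<close>.
\<close>

definition query_assignments :: "nat \<Rightarrow> nat \<Rightarrow> nat \<Rightarrow> (nat \<Rightarrow> (nat \<times> nat) set) set" where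
  "query_assignments m n K =
     {A. (\<forall>i\<in>{1..n}. A i \<subseteq> alt_pairs m \<and> card (A i) = K) \<and>
         (\<forall>e\<in>alt_pairs m. real (card {i\<in>{1..n}. e \<in> A i}) = real n * real K / real (m choose 2))}"

definition laplace_density :: "real \<Rightarrow> real \<Rightarrow> real" where
  "laplace_density b x = exp (- \<bar>x\<bar> / b) / (2 * b)"

type_synonym outcome =
  "((nat \<Rightarrow> (nat \<times> nat) set) \<times> (nat \<Rightarrow> nat \<times> nat \<Rightarrow> bool)) \<times> (nat \<times> (nat \<times> nat) \<Rightarrow> real)"

text \<open>
  Joint law of the query assignment (with law \<open>Q\<close>), the agents' answers (i.i.d. with law \<open>P\<close>) and
  the noise, all independent. The noise is drawn for every agent and every pair, but only its
  values at the queried pairs are used.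
\<close>

definition ldp_space ::
  "nat \<Rightarrow> nat \<Rightarrow> nat \<Rightarrow> real \<Rightarrow> (nat \<Rightarrow> (nat \<times> nat) set) pmf \<Rightarrow> (nat \<times> nat \<Rightarrow> bool) pmf \<Rightarrow> outcome measure"
  where
  "ldp_space m n K \<epsilon> Q P =
     measure_pmf (pair_pmf Q (Pi_pmf {1..n} (\<lambda>_. False) (\<lambda>_. P))) \<Otimes>\<^sub>M
     (\<Pi>\<^sub>M x \<in> {1..n} \<times> alt_pairs m. density lborel (laplace_density (1 / (\<epsilon> / real K))))"

fun report :: "outcome \<Rightarrow> nat \<Rightarrow> nat \<times> nat \<Rightarrow> real" where
  "report ((A, L), X) i e = of_bool (L i e) + X (i, e)"

fun queried :: "outcome \<Rightarrow> nat \<Rightarrow> nat \<times> nat \<Rightarrow> bool" where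
  "queried ((A, L), X) i e \<longleftrightarrow> e \<in> A i"

text \<open>For \<open>j < l\<close>: reports in favour of \<open>j\<close> minus reports in favour of \<open>l\<close>.\<close>

definition cmp_hat :: "nat \<Rightarrow> outcome \<Rightarrow> nat \<times> nat \<Rightarrow> int" where
  "cmp_hat n \<omega> e =
     int (card {i\<in>{1..n}. queried \<omega> i e \<and> report \<omega> i e \<ge> 1 / 2}) -
     int (card {i\<in>{1..n}. queried \<omega> i e \<and> report \<omega> i e < 1 / 2})"

text \<open>A tie has sign \<open>0\<close> and therefore counts as a disagreement.\<close>

definition cmp_error :: "nat \<Rightarrow> nat \<Rightarrow> (nat \<Rightarrow> nat) \<Rightarrow> outcome \<Rightarrow> nat" where
  "cmp_error m n \<sigma> \<omega> =
     card {(j, l) \<in> alt_pairs m. sgn (cmp_hat n \<omega> (j, l)) \<noteq> (if \<sigma> j < \<sigma> l then 1 else -1)}"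

lemma finite_alt_pairs [simp]: "finite (alt_pairs m)"
  by (rule finite_subset[of _ "{1..m} \<times> {1..m}"]) (auto simp: alt_pairs_def)

lemma prob_pairwise_agree:
  assumes "0 \<le> p" "p \<le> 1" "(j, l) \<in> alt_pairs m"
  shows "measure_pmf.prob (pairwise_pmf m p \<sigma>) {v. v (j, l) \<longleftrightarrow> \<sigma> j < \<sigma> l} = p"
proof -
  have eq: "map_pmf (\<lambda>v. v (j, l)) (pairwise_pmf m p \<sigma>) =
      map_pmf (\<lambda>agree. if agree then \<sigma> j < \<sigma> l else \<not> \<sigma> j < \<sigma> l) (bernoulli_pmf p)"
    using assms by (simp add: pairwise_pmf_def Pi_pmf_component)
  have "measure_pmf.prob (pairwise_pmf m p \<sigma>) {v. v (j, l) \<longleftrightarrow> \<sigma> j < \<sigma> l} =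
      measure_pmf.prob (map_pmf (\<lambda>v. v (j, l)) (pairwise_pmf m p \<sigma>)) {b. b \<longleftrightarrow> \<sigma> j < \<sigma> l}"
    by (simp add: vimage_def)
  also have "\<dots> = measure_pmf.prob (bernoulli_pmf p) {True}"
    unfolding eq measure_map_pmf by (rule arg_cong[where f = "measure _"]) auto
  also have "\<dots> = p"
    using assms by (simp add: measure_pmf_single)
  finally show ?thesis .
qed

text \<open>The conditioning event of \<open>mallows_pmf\<close> has positive probability.\<close>

lemma mallows_pmf_nonempty:
  assumes "0 < p" "p \<le> 1" "\<sigma> permutes {1..m}"
  shows "set_pmf (pairwise_pmf m p \<sigma>) \<inter> ranking_answers m \<noteq> {}"
proof -
  have "True \<in> set_pmf (bernoulli_pmf p)"
    using assms by (simp add: set_pmf_iff)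
  then have "answers_of m \<sigma> \<in> set_pmf (pairwise_pmf m p \<sigma>)"
    by (force simp: pairwise_pmf_def set_Pi_pmf PiE_dflt_def answers_of_def)
  then show ?thesis
    using assms by (auto simp: ranking_answers_def)
qed

end

theory Submission
  imports Defs
begin

text \<open>
  A report on a pair agrees with the ground truth with bias \<open>t = \<delta> g\<close>, where \<open>\<delta> = 2 p - 1 = \<theta>s\<close> and
  \<open>g = 1 - exp (- \<epsilon> / (2 K))\<close>. The heart of the proof is that for every set \<open>T\<close> of pairs the probability
  that all pairs of \<open>T\<close> are wrong is at most \<open>s ^ card T\<close>, with \<open>s\<close> the Chernoff bound for one pair. For
  independent pairs this is clear. In the Mallows model, where the answers of an agent are
  dependent, the exponential moments are still bounded by those of the independent model: after
  tilting, this says that the sum over all rankings of the product of the factors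
  \<open>1 + y e * (\<plusminus> 1)\<close>, with sign \<open>+\<close> when \<open>e\<close> is ordered as in the ground truth, is maximal
  among all \<open>0 \<le> y \<le> \<delta>\<close> at \<open>y = \<delta>\<close>. Finally the bounds \<open>s ^ card T\<close> give
  \<open>(1 + 3 s) ^ (m choose 2)\<close> as a bound for the expectation of \<open>4\<close> to the number of errors.
\<close>

section \<open>Sums over rankings\<close>

definition agree_sign :: "(nat \<Rightarrow> nat) \<Rightarrow> (nat \<Rightarrow> nat) \<Rightarrow> nat \<Rightarrow> nat \<Rightarrow> real" where
  "agree_sign \<sigma> \<tau> a b = (if \<tau> a < \<tau> b \<longleftrightarrow> \<sigma> a < \<sigma> b then 1 else - 1)"

text \<open>Pairs are oriented by the ground truth, not by index, so that a pair
  \<open>(a, b)\<close> contributes the sign \<open>+\<close> exactly when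
  \<open>\<tau> a < \<tau> b\<close>.\<close>

definition ordered_pairs :: "nat \<Rightarrow> (nat \<Rightarrow> nat) \<Rightarrow> (nat \<times> nat) set" where
  "ordered_pairs m \<sigma> = {(a, b). a \<in> {1..m} \<and> b \<in> {1..m} \<and> \<sigma> a < \<sigma> b}"

text \<open>With \<open>y f = 2 * p - 1\<close> this is twice the probability, \<open>p\<close> or
  \<open>1 - p\<close>, of the order that \<open>\<tau>\<close> gives to the pair.\<close>

definition pair_factor ::
  "(nat \<Rightarrow> nat) \<Rightarrow> (nat \<times> nat \<Rightarrow> real) \<Rightarrow> (nat \<Rightarrow> nat) \<Rightarrow> nat \<times> nat \<Rightarrow> real" where
  "pair_factor \<sigma> y \<tau> f = 1 + y f * agree_sign \<sigma> \<tau> (fst f) (snd f)"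

text \<open>
  With \<open>y = \<delta>\<close> constant this is, up to a power of \<open>2\<close>, the normalising constant of the Mallows model
  with \<open>p = (1 + \<delta>) / 2\<close>.
\<close>

definition weight_sum :: "nat \<Rightarrow> (nat \<Rightarrow> nat) \<Rightarrow> (nat \<times> nat \<Rightarrow> real) \<Rightarrow> real" where
  "weight_sum m \<sigma> y = (\<Sum>\<tau> | \<tau> permutes {1..m}. \<Prod>f\<in>ordered_pairs m \<sigma>. pair_factor \<sigma> y \<tau> f)"

lemma finite_ordered_pairs [simp]: "finite (ordered_pairs m \<sigma>)"
  by (rule finite_subset[of _ "{1..m} \<times> {1..m}"]) (auto simp: ordered_pairs_def)

lemma pair_factor_nonneg:
  assumes "0 \<le> y f" "y f \<le> 1"
  shows "0 \<le> pair_factor \<sigma> y \<tau> f"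
  using assms by (auto simp: pair_factor_def agree_sign_def)

definition orient :: "(nat \<Rightarrow> nat) \<Rightarrow> nat \<Rightarrow> nat \<Rightarrow> nat \<times> nat" where
  "orient \<sigma> a c = (if \<sigma> a < \<sigma> c then (a, c) else (c, a))"

text \<open>A pair other than \<open>(a, b)\<close> that meets \<open>{a, b}\<close> contains
  exactly one third alternative \<open>c\<close>. Grouping by \<open>c\<close> lets the effect of
  exchanging \<open>a\<close> and \<open>b\<close> be compared for each \<open>c\<close>
  separately.\<close>

lemma prod_ordered_pairs_split:
  fixes F :: "nat \<times> nat \<Rightarrow> real"
  assumes inj: "inj \<sigma>" and ab: "(a, b) \<in> ordered_pairs m \<sigma>"
  shows "(\<Prod>f\<in>ordered_pairs m \<sigma> - {(a, b)}. F f) =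
    (\<Prod>f | f \<in> ordered_pairs m \<sigma> \<and> {fst f, snd f} \<inter> {a, b} = {}. F f) *
    (\<Prod>c\<in>{1..m} - {a, b}. F (orient \<sigma> a c) * F (orient \<sigma> b c))"
proof -
  let ?E = "ordered_pairs m \<sigma>" and ?C = "{1..m} - {a, b}"
  let ?D = "{f \<in> ?E. {fst f, snd f} \<inter> {a, b} = {}}"
  have neq: "\<sigma> u < \<sigma> v \<or> \<sigma> v < \<sigma> u" if "u \<noteq> v" for u v
    using inj that by (metis injD linorder_neqE_nat)
  have ab': "a \<in> {1..m}" "b \<in> {1..m}" "\<sigma> a < \<sigma> b" "a \<noteq> b"
    using ab by (auto simp: ordered_pairs_def)
  have inj_or: "inj_on (orient \<sigma> u) ?C" if "u \<in> {a, b}" for u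
    using that by (auto simp: inj_on_def orient_def split: if_splits)
  have eq: "?E - {(a, b)} = ?D \<union> (orient \<sigma> a ` ?C \<union> orient \<sigma> b ` ?C)"
  proof (intro equalityI subsetI)
    fix f assume f: "f \<in> ?E - {(a, b)}"
    obtain u v where uv: "f = (u, v)" by fastforce
    have *: "u \<in> {1..m}" "v \<in> {1..m}" "\<sigma> u < \<sigma> v" "(u, v) \<noteq> (a, b)" "u \<noteq> v"
      using f uv by (auto simp: ordered_pairs_def)
    have **: "(u, v) \<noteq> (b, a)" using * ab' by auto
    show "f \<in> ?D \<union> (orient \<sigma> a ` ?C \<union> orient \<sigma> b ` ?C)"
    proof (cases "{u, v} \<inter> {a, b} = {}")
      case True
      then show ?thesis using f uv by auto
    next
      case False
      then consider "u = a" "v \<in> ?C" | "u = b" "v \<in> ?C" | "v = a" "u \<in> ?C" | "v = b" "u \<in> ?C"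
        using * ** by blast
      then show ?thesis
      proof cases
        case 1
        then have "f = orient \<sigma> a v" using * uv by (simp add: orient_def)
        then show ?thesis using 1 by blast
      next
        case 2
        then have "f = orient \<sigma> b v" using * uv by (simp add: orient_def)
        then show ?thesis using 2 by blast
      next
        case 3
        then have "f = orient \<sigma> a u" using * uv by (simp add: orient_def)
        then show ?thesis using 3 by blast
      next
        case 4
        then have "f = orient \<sigma> b u" using * uv by (simp add: orient_def)
        then show ?thesis using 4 by blast
      qed
    qed
  next
    fix f assume f: "f \<in> ?D \<union> (orient \<sigma> a ` ?C \<union> orient \<sigma> b ` ?C)"
    have "orient \<sigma> u c \<in> ?E - {(a, b)}" if u: "u \<in> {a, b}" and c: "c \<in> ?C" for u c
    proof -
      have "u \<noteq> c" "u \<in> {1..m}" using u c ab' by auto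
      then show ?thesis
        using neq[of u c] c by (auto simp: orient_def ordered_pairs_def)
    qed
    then show "f \<in> ?E - {(a, b)}" using f by auto
  qed
  have disj1: "orient \<sigma> a ` ?C \<inter> orient \<sigma> b ` ?C = {}"
    using ab'(4) by (auto simp: orient_def split: if_splits)
  have disj0: "?D \<inter> (orient \<sigma> a ` ?C \<union> orient \<sigma> b ` ?C) = {}"
    by (auto simp: orient_def split: if_splits)
  have "(\<Prod>f\<in>?E - {(a, b)}. F f) =
      prod F ?D * (prod F (orient \<sigma> a ` ?C) * prod F (orient \<sigma> b ` ?C))"
    unfolding eq using prod.union_disjoint[OF _ _ disj0, of F] prod.union_disjoint[OF _ _ disj1, of F]
    by simp
  also have "\<dots> = prod F ?D * (\<Prod>c\<in>?C. F (orient \<sigma> a c) * F (orient \<sigma> b c))"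
    using inj_or by (simp add: prod.reindex prod.distrib)
  finally show ?thesis .
qed

text \<open>Both sides are equal unless \<open>\<tau>\<close> places \<open>c\<close> between
  \<open>a\<close> and \<open>b\<close>. In that case, if \<open>c\<close> also lies between them in
  \<open>\<sigma>\<close>, the exchange turns two signs \<open>+\<close> into two signs
  \<open>-\<close>. If \<open>c\<close> lies outside, the signs are opposite and the exchange swaps
  them; \<open>up\<close> and \<open>dn\<close> say that before the exchange the \<open>+\<close> is
  on the pair with the larger value.\<close>

lemma swap_factor_le:
  assumes inj: "inj \<sigma>" "inj \<tau>" and "\<sigma> a < \<sigma> b" "\<tau> a < \<tau> b" "c \<noteq> a" "c \<noteq> b"
    and y: "\<And>f. 0 \<le> y f" "\<And>f. y f \<le> 1"
    and up: "\<sigma> b < \<sigma> c \<Longrightarrow> y (b, c) \<le> y (a, c)"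
    and dn: "\<sigma> c < \<sigma> a \<Longrightarrow> y (c, a) \<le> y (c, b)"
  shows "pair_factor \<sigma> y (\<tau> \<circ> Transposition.transpose a b) (orient \<sigma> a c) *
         pair_factor \<sigma> y (\<tau> \<circ> Transposition.transpose a b) (orient \<sigma> b c) \<le>
         pair_factor \<sigma> y \<tau> (orient \<sigma> a c) * pair_factor \<sigma> y \<tau> (orient \<sigma> b c)"
proof -
  have neq: "\<sigma> c \<noteq> \<sigma> a" "\<sigma> c \<noteq> \<sigma> b" "\<tau> c \<noteq> \<tau> a" "\<tau> c \<noteq> \<tau> b"
    using assms by (auto dest: injD)
  have *: "(1 - u) * (1 + v) \<le> (1 + u) * (1 - v)" if "v \<le> u" for u v :: real
    using that by (simp add: algebra_simps)
  have **: "(1 - u) * (1 - v) \<le> (1 + u) * (1 + v)" if "0 \<le> u" "0 \<le> v" for u v :: real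
    using that by (simp add: algebra_simps)
  have \<tau>: "\<tau> c < \<tau> a \<or> \<tau> a < \<tau> c \<and> \<tau> c < \<tau> b \<or> \<tau> b < \<tau> c"
    using neq by linarith
  consider "\<sigma> c < \<sigma> a" | "\<sigma> a < \<sigma> c" "\<sigma> c < \<sigma> b" | "\<sigma> b < \<sigma> c"
    using neq by linarith
  then show ?thesis
  proof cases
    case 1
    then show ?thesis
      using \<tau> assms(3-6) *[OF dn[OF 1]]
      by (elim disjE) (auto simp: pair_factor_def agree_sign_def orient_def mult.commute)
  next
    case 2
    then show ?thesis
      using \<tau> assms(3-6) **[OF y(1) y(1), of "(a, c)" "(c, b)"]
      by (elim disjE) (auto simp: pair_factor_def agree_sign_def orient_def mult.commute)
  next
    case 3
    then show ?thesis
      using \<tau> assms(3-6) *[OF up[OF 3]]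
      by (elim disjE) (auto simp: pair_factor_def agree_sign_def orient_def mult.commute)
  qed
qed

text \<open>
  The derivative in the coordinate \<open>(a, b)\<close> is nonnegative because exchanging \<open>a\<close> and \<open>b\<close> in a ranking
  that orders them correctly can only decrease the product of the other factors.
\<close>

lemma weight_sum_mono_step:
  assumes inj: "inj \<sigma>" and ab: "(a, b) \<in> ordered_pairs m \<sigma>"
    and y: "\<And>f. 0 \<le> y f" "\<And>f. y f \<le> 1" and "y (a, b) \<le> v"
    and up: "\<And>c. c \<in> {1..m} \<Longrightarrow> \<sigma> b < \<sigma> c \<Longrightarrow> y (b, c) \<le> y (a, c)"
    and dn: "\<And>c. c \<in> {1..m} \<Longrightarrow> \<sigma> c < \<sigma> a \<Longrightarrow> y (c, a) \<le> y (c, b)"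
  shows "weight_sum m \<sigma> y \<le> weight_sum m \<sigma> (y((a, b) := v))"
proof -
  let ?S = "{\<tau>. \<tau> permutes {1..m}}" and ?E = "ordered_pairs m \<sigma>"
  define W where "W \<tau> = (\<Prod>f\<in>?E - {(a, b)}. pair_factor \<sigma> y \<tau> f)" for \<tau>
  define s where "s \<tau> = agree_sign \<sigma> \<tau> a b" for \<tau>
  have ab': "a \<in> {1..m}" "b \<in> {1..m}" "\<sigma> a < \<sigma> b" "a \<noteq> b"
    using ab by (auto simp: ordered_pairs_def)
  \<comment> \<open>The product is affine in the single value at \<open>(a, b)\<close>, so
    monotonicity reduces to the sign of the slope.\<close>
  have split: "weight_sum m \<sigma> (y((a, b) := u)) = (\<Sum>\<tau>\<in>?S. W \<tau>) + u * (\<Sum>\<tau>\<in>?S. s \<tau> * W \<tau>)" for u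
  proof -
    have "(\<Prod>f\<in>?E. pair_factor \<sigma> (y((a, b) := u)) \<tau> f) = W \<tau> + u * (s \<tau> * W \<tau>)" for \<tau>
    proof -
      have "(\<Prod>f\<in>?E - {(a, b)}. pair_factor \<sigma> (y((a, b) := u)) \<tau> f) = W \<tau>"
        unfolding W_def by (intro prod.cong) (auto simp: pair_factor_def)
      then show ?thesis
        using prod.remove[OF finite_ordered_pairs ab, of "pair_factor \<sigma> (y((a, b) := u)) \<tau>"]
        by (simp add: pair_factor_def s_def algebra_simps)
    qed
    then show ?thesis
      by (simp add: weight_sum_def sum.distrib sum_distrib_left)
  qed
  let ?t = "Transposition.transpose a b"
  have perm: "\<tau> \<circ> ?t permutes {1..m}" if "\<tau> permutes {1..m}" for \<tau>
    using ab' that by (intro permutes_compose permutes_swap_id) auto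
  have s_swap: "s (\<tau> \<circ> ?t) = - s \<tau>" if "\<tau> permutes {1..m}" for \<tau>
  proof -
    have "\<tau> a \<noteq> \<tau> b"
      using permutes_inj[OF that] ab' by (auto dest: injD)
    then show ?thesis by (auto simp: s_def agree_sign_def)
  qed
  \<comment> \<open>Composition with the transposition is an involution on rankings that flips
    \<open>s\<close>. Averaging the slope with its reindexed form leaves the terms
    \<open>s \<tau> * (W \<tau> - W (\<tau> \<circ> ?t))\<close>, which have a sign.\<close>
  have swap: "(\<Sum>\<tau>\<in>?S. s \<tau> * W \<tau>) = (\<Sum>\<tau>\<in>?S. - s \<tau> * W (\<tau> \<circ> ?t))"
    by (rule sum.reindex_bij_witness[of _ "\<lambda>\<tau>. \<tau> \<circ> ?t" "\<lambda>\<tau>. \<tau> \<circ> ?t"])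
       (auto simp: perm s_swap comp_assoc simp del: One_nat_def)
  have le: "W (\<tau> \<circ> ?t) \<le> W \<tau>" if "\<tau> permutes {1..m}" "\<tau> a < \<tau> b" for \<tau>
  proof -
    have "(\<Prod>c\<in>{1..m} - {a, b}. pair_factor \<sigma> y (\<tau> \<circ> ?t) (orient \<sigma> a c) *
             pair_factor \<sigma> y (\<tau> \<circ> ?t) (orient \<sigma> b c)) \<le>
          (\<Prod>c\<in>{1..m} - {a, b}. pair_factor \<sigma> y \<tau> (orient \<sigma> a c) * pair_factor \<sigma> y \<tau> (orient \<sigma> b c))"
      using that ab' y up dn inj permutes_inj[OF that(1)]
      by (intro prod_mono conjI swap_factor_le mult_nonneg_nonneg pair_factor_nonneg) auto
    moreover have "(\<Prod>f | f \<in> ?E \<and> {fst f, snd f} \<inter> {a, b} = {}. pair_factor \<sigma> y (\<tau> \<circ> ?t) f) =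
        (\<Prod>f | f \<in> ?E \<and> {fst f, snd f} \<inter> {a, b} = {}. pair_factor \<sigma> y \<tau> f)"
      by (intro prod.cong) (auto simp: pair_factor_def agree_sign_def Transposition.transpose_def)
    moreover have "0 \<le> (\<Prod>f | f \<in> ?E \<and> {fst f, snd f} \<inter> {a, b} = {}. pair_factor \<sigma> y \<tau> f)"
      using y by (intro prod_nonneg) (auto intro: pair_factor_nonneg)
    ultimately show ?thesis
      unfolding W_def prod_ordered_pairs_split[OF inj ab] by (simp add: mult_left_mono)
  qed
  \<comment> \<open>When \<open>\<tau>\<close> has \<open>b\<close> first, \<open>s \<tau>\<close>
    is \<open>-1\<close> and \<open>le\<close> is applied to the exchanged ranking, whose own
    exchange is \<open>\<tau>\<close> again.\<close>
  have "0 \<le> s \<tau> * W \<tau> - s \<tau> * W (\<tau> \<circ> ?t)" if \<tau>: "\<tau> permutes {1..m}" for \<tau>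
  proof (cases "\<tau> a < \<tau> b")
    case True
    then show ?thesis using le[OF \<tau>] ab' by (simp add: s_def agree_sign_def)
  next
    case False
    then have "\<tau> b < \<tau> a"
      using permutes_inj[OF \<tau>] ab' by (metis injD linorder_neqE_nat)
    then show ?thesis
      using le[OF perm[OF \<tau>]] ab' False by (simp add: s_def agree_sign_def comp_assoc)
  qed
  then have "0 \<le> (\<Sum>\<tau>\<in>?S. s \<tau> * W \<tau> - s \<tau> * W (\<tau> \<circ> ?t))"
    by (intro sum_nonneg) auto
  also have "\<dots> = 2 * (\<Sum>\<tau>\<in>?S. s \<tau> * W \<tau>)"
    using swap by (simp add: sum_subtractf sum_negf)
  finally have "0 \<le> (\<Sum>\<tau>\<in>?S. s \<tau> * W \<tau>)" by simp
  then have "y (a, b) * (\<Sum>\<tau>\<in>?S. s \<tau> * W \<tau>) \<le> v * (\<Sum>\<tau>\<in>?S. s \<tau> * W \<tau>)"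
    using assms by (intro mult_right_mono) auto
  then show ?thesis
    using split[of v] split[of "y (a, b)"] by simp
qed

text \<open>
  Raise the pairs to \<open>\<delta>\<close> one at a time, those farthest apart in \<open>\<sigma>\<close> first; then every pair that
  extends the current one beyond one of its ends already carries the maximal value \<open>\<delta>\<close>, which is
  what makes each step monotone.
\<close>

lemma weight_sum_le_const:
  assumes inj: "inj \<sigma>" and "\<delta> \<le> 1" and "\<And>f. 0 \<le> y f" "\<And>f. y f \<le> \<delta>"
  shows "weight_sum m \<sigma> y \<le> weight_sum m \<sigma> (\<lambda>_. \<delta>)"
  using assms(3,4)
proof (induction "card {f \<in> ordered_pairs m \<sigma>. y f \<noteq> \<delta>}" arbitrary: y rule: less_induct)
  case less
  let ?U = "\<lambda>y. {f \<in> ordered_pairs m \<sigma>. y f \<noteq> \<delta>}"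
  show ?case
  proof (cases "?U y = {}")
    case True
    then show ?thesis
      unfolding weight_sum_def by (intro sum_mono eq_refl prod.cong) (auto simp: pair_factor_def)
  next
    case False
    let ?len = "\<lambda>f. \<sigma> (snd f) - \<sigma> (fst f)"
    define L where "L = Max (?len ` ?U y)"
    have fin: "finite (?len ` ?U y)" by simp
    have "L \<in> ?len ` ?U y"
      unfolding L_def using False fin by (intro Max_in) auto
    then obtain e where e: "e \<in> ?U y" "L = ?len e" by auto
    have longest: "y f = \<delta>" if "f \<in> ordered_pairs m \<sigma>" "?len e < ?len f" for f
      using that e(2) Max_ge[OF fin, of "?len f"] by (fastforce simp: L_def)
    obtain a b where ab: "e = (a, b)" by fastforce
    have "weight_sum m \<sigma> y \<le> weight_sum m \<sigma> (y(e := \<delta>))"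
      unfolding ab
    proof (rule weight_sum_mono_step[OF inj])
      have ab': "a \<in> {1..m}" "b \<in> {1..m}" "\<sigma> a < \<sigma> b"
        using e ab by (auto simp: ordered_pairs_def)
      show "(a, b) \<in> ordered_pairs m \<sigma>" using e ab by simp
      show "0 \<le> y f" "y f \<le> 1" "y (a, b) \<le> \<delta>" for f
        using less.prems[of f] less.prems[of "(a, b)"] \<open>\<delta> \<le> 1\<close> by auto
      \<comment> \<open>In \<open>\<sigma>\<close> the pair \<open>(a, c)\<close> is farther apart
        than \<open>(a, b)\<close>, so it already has the value \<open>\<delta>\<close>, an upper
        bound for \<open>y (b, c)\<close>. The other side is symmetric.\<close>
      show "y (b, c) \<le> y (a, c)" if "c \<in> {1..m}" "\<sigma> b < \<sigma> c" for c
        using longest[of "(a, c)"] that ab' ab less.prems by (auto simp: ordered_pairs_def)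
      show "y (c, a) \<le> y (c, b)" if "c \<in> {1..m}" "\<sigma> c < \<sigma> a" for c
        using longest[of "(c, b)"] that ab' ab less.prems by (auto simp: ordered_pairs_def)
    qed
    also have "\<dots> \<le> weight_sum m \<sigma> (\<lambda>_. \<delta>)"
    proof (rule less.hyps)
      show "card (?U (y(e := \<delta>))) < card (?U y)"
        using e by (intro psubset_card_mono) auto
    next
      show "0 \<le> (y(e := \<delta>)) f" "(y(e := \<delta>)) f \<le> \<delta>" for f
        using less.prems[of f] less.prems[of e] by auto
    qed
    finally show ?thesis .
  qed
qed

section \<open>Exponential moments of one agent's answers\<close>

definition answer_sign :: "(nat \<Rightarrow> nat) \<Rightarrow> (nat \<times> nat \<Rightarrow> bool) \<Rightarrow> nat \<times> nat \<Rightarrow> real" where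
  "answer_sign \<sigma> v e = (if v e \<longleftrightarrow> \<sigma> (fst e) < \<sigma> (snd e) then 1 else - 1)"

text \<open>The answers determine all comparisons, and these determine the position of
  \<open>j\<close> as one plus the number of alternatives before it. This turns sums over answer
  vectors into sums over permutations.\<close>

lemma inj_on_answers_of: "inj_on (answers_of m) {\<tau>. \<tau> permutes {1..m}}"
proof (rule inj_onI)
  fix \<tau> \<tau>' assume "\<tau> \<in> {\<tau>. \<tau> permutes {1..m}}" "\<tau>' \<in> {\<tau>. \<tau> permutes {1..m}}"
    and eq: "answers_of m \<tau> = answers_of m \<tau>'"
  then have perm: "\<tau> permutes {1..m}" "\<tau>' permutes {1..m}" by simp_all
  have iff: "\<tau> j < \<tau> l \<longleftrightarrow> \<tau>' j < \<tau>' l" if "j \<in> {1..m}" "l \<in> {1..m}" for j l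
  proof -
    have lt: "\<tau> j < \<tau> l \<longleftrightarrow> \<tau>' j < \<tau>' l" if "j \<in> {1..m}" "l \<in> {1..m}" "j < l" for j l
      using fun_cong[OF eq, of "(j, l)"] that by (auto simp: answers_of_def alt_pairs_def)
    have ne: "\<rho> j \<noteq> \<rho> l" if "\<rho> permutes {1..m}" "j \<noteq> l" for \<rho> :: "nat \<Rightarrow> nat" and j l
      using permutes_inj[OF that(1)] that(2) by (auto dest: injD)
    consider "j < l" | "j = l" | "l < j" by linarith
    then show ?thesis
    proof cases
      case 3
      then show ?thesis
        using lt[of l j] that ne[OF perm(1), of j l] ne[OF perm(2), of j l] by auto
    qed (use that lt in auto)
  qed
  \<comment> \<open>Positions start at \<open>1\<close>, so the alternatives before \<open>j\<close>
    fill \<open>{1..<\<rho> j}\<close>; hence the \<open>Suc\<close>.\<close>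
  have rank: "\<rho> j = Suc (card {l \<in> {1..m}. \<rho> l < \<rho> j})"
    if "\<rho> permutes {1..m}" "j \<in> {1..m}" for \<rho> :: "nat \<Rightarrow> nat" and j
  proof -
    have "\<rho> ` {l \<in> {1..m}. \<rho> l < \<rho> j} = {1..<\<rho> j}"
    proof (intro equalityI subsetI)
      fix x assume "x \<in> \<rho> ` {l \<in> {1..m}. \<rho> l < \<rho> j}"
      then show "x \<in> {1..<\<rho> j}"
        using permutes_in_image[OF that(1)] by fastforce
    next
      fix x assume x: "x \<in> {1..<\<rho> j}"
      then have "x \<in> {1..m}"
        using permutes_in_image[OF that(1), of j] that(2) by auto
      then have "x \<in> \<rho> ` {1..m}"
        using permutes_image[OF that(1)] by simp
      then obtain l where "l \<in> {1..m}" "x = \<rho> l" by blast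
      then show "x \<in> \<rho> ` {l \<in> {1..m}. \<rho> l < \<rho> j}"
        using x by auto
    qed
    moreover have "inj_on \<rho> {l \<in> {1..m}. \<rho> l < \<rho> j}"
      using permutes_inj[OF that(1)] by (auto intro: inj_on_subset)
    ultimately have "card {l \<in> {1..m}. \<rho> l < \<rho> j} = \<rho> j - 1"
      using card_image by fastforce
    moreover have "1 \<le> \<rho> j" using permutes_in_image[OF that(1), of j] that(2) by auto
    ultimately show ?thesis by simp
  qed
  show "\<tau> = \<tau>'"
  proof
    fix j show "\<tau> j = \<tau>' j"
    proof (cases "j \<in> {1..m}")
      case True
      then have "{l \<in> {1..m}. \<tau> l < \<tau> j} = {l \<in> {1..m}. \<tau>' l < \<tau>' j}"
        using iff by auto
      then show ?thesis using rank[OF perm(1) True] rank[OF perm(2) True] by simp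
    qed (use perm in \<open>auto simp: permutes_not_in\<close>)
  qed
qed

lemma finite_ranking_answers [simp]: "finite (ranking_answers m)"
  by (simp add: ranking_answers_def finite_permutations)

text \<open>Queries are oriented by index and \<open>ordered_pairs\<close> by
  \<open>\<sigma>\<close>. Reversing a pair reverses its order in both rankings, so the agreement
  sign is the same for either orientation.\<close>

lemma sum_ranking_answers:
  assumes "\<sigma> permutes {1..m}"
  shows "(\<Sum>v\<in>ranking_answers m. \<Prod>e\<in>alt_pairs m. 1 + x e * answer_sign \<sigma> v e) =
    weight_sum m \<sigma> (\<lambda>(a, b). x (if a < b then (a, b) else (b, a)))"
proof -
  have ne: "\<rho> j \<noteq> \<rho> l" if "\<rho> permutes {1..m}" "j \<noteq> l" for \<rho> :: "nat \<Rightarrow> nat" and j l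
    using permutes_inj[OF that(1)] that(2) by (auto dest: injD)
  have "(\<Prod>e\<in>alt_pairs m. 1 + x e * answer_sign \<sigma> (answers_of m \<tau>) e) =
    (\<Prod>f\<in>ordered_pairs m \<sigma>. pair_factor \<sigma> (\<lambda>(a, b). x (if a < b then (a, b) else (b, a))) \<tau> f)"
    if \<tau>: "\<tau> permutes {1..m}" for \<tau>
  \<comment> \<open>The two maps reorient a pair by index and by \<open>\<sigma>\<close>; they are
    inverse to each other.\<close>
  proof (rule prod.reindex_bij_witness[of _ "\<lambda>(a, b). if a < b then (a, b) else (b, a)"
        "\<lambda>(a, b). if \<sigma> a < \<sigma> b then (a, b) else (b, a)"], goal_cases)
    case (2 e)
    then show ?case
      using ne[OF assms, of "fst e" "snd e"]
      by (auto simp: alt_pairs_def ordered_pairs_def split: if_splits)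
  next
    case (4 f)
    then show ?case
      by (cases f) (auto simp: alt_pairs_def ordered_pairs_def linorder_neq_iff[symmetric] not_less_iff_gr_or_eq)
  next
    case (5 e)
    then show ?case
      using ne[OF assms, of "fst e" "snd e"] ne[OF \<tau>, of "fst e" "snd e"]
      by (cases e) (auto simp: alt_pairs_def pair_factor_def answer_sign_def agree_sign_def answers_of_def)
  qed (auto simp: alt_pairs_def ordered_pairs_def)
  then show ?thesis
    unfolding ranking_answers_def weight_sum_def
    by (subst sum.reindex[OF inj_on_answers_of]) simp
qed

text \<open>Writing \<open>p\<close> and \<open>1 - p\<close> as
  \<open>(1 + (2 * p - 1) * s) / 2\<close> with \<open>s\<close> a sign brings the law into the
  shape of \<open>pair_factor\<close>.\<close>

lemma pmf_pairwise:
  assumes "0 \<le> p" "p \<le> 1" "v \<in> ranking_answers m"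
  shows "pmf (pairwise_pmf m p \<sigma>) v = (\<Prod>e\<in>alt_pairs m. (1 + (2 * p - 1) * answer_sign \<sigma> v e) / 2)"
proof -
  \<comment> \<open>\<open>Pi_pmf\<close> gives mass only to functions with the default value
    \<open>False\<close> outside \<open>alt_pairs m\<close>.\<close>
  have "v e = False" if "e \<notin> alt_pairs m" for e
    using assms(3) that by (auto simp: ranking_answers_def answers_of_def split: prod.splits)
  moreover have "pmf (case e of (j, l) \<Rightarrow> map_pmf (\<lambda>agree. if agree then \<sigma> j < \<sigma> l else \<not> \<sigma> j < \<sigma> l)
      (bernoulli_pmf p)) (v e) = (1 + (2 * p - 1) * answer_sign \<sigma> v e) / 2" for e
  proof -
    obtain j l where e: "e = (j, l)" by fastforce
    have "(\<lambda>agree. if agree then \<sigma> j < \<sigma> l else \<not> \<sigma> j < \<sigma> l) -` {v e} = {v e \<longleftrightarrow> \<sigma> j < \<sigma> l}"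
      by auto
    then show ?thesis
      using assms by (auto simp: e pmf_map measure_pmf_single answer_sign_def)
  qed
  ultimately show ?thesis
    unfolding pairwise_pmf_def by (subst pmf_Pi') (simp_all only: finite_alt_pairs)
qed

text \<open>The answers to different pairs are independent, and each factor has mean
  \<open>C\<close>.\<close>

lemma pairwise_product_bound:
  fixes h :: "real \<Rightarrow> real"
  assumes p: "0 \<le> p" "p \<le> 1" and T: "T \<subseteq> alt_pairs m"
    and h: "0 \<le> h 1" "0 \<le> h (- 1)" and C: "p * h 1 + (1 - p) * h (- 1) = C"
  shows "(\<integral>\<^sup>+v. (\<Prod>e\<in>T. ennreal (h (answer_sign \<sigma> v e))) \<partial>pairwise_pmf m p \<sigma>) = ennreal (C ^ card T)"
proof -
  define f where "f e b = (if e \<in> T then ennreal (h (answer_sign \<sigma> (\<lambda>_. b) e)) else 1)" for e b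
  have C0: "0 \<le> C" using C h p by auto
  have "(\<Prod>e\<in>T. ennreal (h (answer_sign \<sigma> v e))) = (\<Prod>e\<in>alt_pairs m. f e (v e))" for v
    unfolding f_def using T
    by (simp add: prod.If_cases Int_absorb1 answer_sign_def)
  then have "(\<integral>\<^sup>+v. (\<Prod>e\<in>T. ennreal (h (answer_sign \<sigma> v e))) \<partial>pairwise_pmf m p \<sigma>) =
    (\<Prod>e\<in>alt_pairs m. \<integral>\<^sup>+b. f e b \<partial>(case e of (j, l) \<Rightarrow>
       map_pmf (\<lambda>agree. if agree then \<sigma> j < \<sigma> l else \<not> \<sigma> j < \<sigma> l) (bernoulli_pmf p)))"
    unfolding pairwise_pmf_def by (simp add: nn_integral_prod_Pi_pmf)
  also have "\<dots> = (\<Prod>e\<in>alt_pairs m. if e \<in> T then ennreal C else 1)"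
  proof (intro prod.cong refl)
    fix e :: "nat \<times> nat"
    obtain j l where e: "e = (j, l)" by fastforce
    show "(\<integral>\<^sup>+b. f e b \<partial>(case e of (j, l) \<Rightarrow>
       map_pmf (\<lambda>agree. if agree then \<sigma> j < \<sigma> l else \<not> \<sigma> j < \<sigma> l) (bernoulli_pmf p))) =
       (if e \<in> T then ennreal C else 1)"
      using p h ennreal_plus[of p "1 - p"] by (auto simp del: ennreal_plus simp: e f_def answer_sign_def C[symmetric] ennreal_plus ennreal_mult mult.commute)
  qed
  also have "\<dots> = ennreal (C ^ card T)"
    using T C0 by (simp add: prod.If_cases Int_absorb1 ennreal_power)
  finally show ?thesis .
qed

text \<open>By \<open>hC\<close>, tilting the weight \<open>1 + (2 * p - 1) * s\<close> by
  \<open>h\<close> gives a weight of the same shape with a smaller parameter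
  \<open>\<gamma>\<close>, times \<open>C\<close>. The expectation is therefore
  \<open>C ^ card T\<close> times a quotient of two values of \<open>weight_sum\<close>: the
  numerator has \<open>\<gamma>\<close> on \<open>T\<close> and \<open>2 * p - 1\<close> elsewhere,
  the denominator has \<open>2 * p - 1\<close> everywhere. By \<open>weight_sum_le_const\<close> the
  quotient is at most \<open>1\<close>.\<close>

lemma mallows_product_bound:
  fixes h :: "real \<Rightarrow> real"
  assumes p: "1 / 2 \<le> p" "p \<le> 1" and \<sigma>: "\<sigma> permutes {1..m}" and T: "T \<subseteq> alt_pairs m"
    and h: "0 \<le> h 1" "0 \<le> h (- 1)" and "0 \<le> C" "0 \<le> \<gamma>" "\<gamma> \<le> 2 * p - 1"
    and hC: "\<And>s. s \<in> {1, - 1} \<Longrightarrow> (1 + (2 * p - 1) * s) * h s = C * (1 + \<gamma> * s)"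
  shows "(\<integral>\<^sup>+v. (\<Prod>e\<in>T. ennreal (h (answer_sign \<sigma> v e))) \<partial>mallows_pmf m p \<sigma>) \<le> ennreal (C ^ card T)"
proof -
  define \<delta> where "\<delta> = 2 * p - 1"
  define Z where "Z = measure_pmf.prob (pairwise_pmf m p \<sigma>) (ranking_answers m)"
  define H where "H v = (\<Prod>e\<in>T. h (answer_sign \<sigma> v e))" for v
  have ne: "set_pmf (pairwise_pmf m p \<sigma>) \<inter> ranking_answers m \<noteq> {}"
    using p \<sigma> by (intro mallows_pmf_nonempty) auto
  have sign: "answer_sign \<sigma> v e \<in> {1, - 1}" for v e
    by (simp add: answer_sign_def)
  have h0: "0 \<le> h (answer_sign \<sigma> v e)" for v e
    using h by (simp add: answer_sign_def)
  have H0: "0 \<le> H v" for v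
    unfolding H_def using h0 by (intro prod_nonneg) auto
  have Zpos: "0 < Z"
    using ne measure_measure_pmf_not_zero[OF ne] by (simp add: Z_def zero_less_measure_iff)
  let ?y = "\<lambda>e. if e \<in> T then \<gamma> else \<delta>"
  have fac: "pmf (pairwise_pmf m p \<sigma>) v * H v =
      C ^ card T / 2 ^ card (alt_pairs m) * (\<Prod>e\<in>alt_pairs m. 1 + ?y e * answer_sign \<sigma> v e)"
    if v: "v \<in> ranking_answers m" for v
  proof -
    have "pmf (pairwise_pmf m p \<sigma>) v * H v = (\<Prod>e\<in>alt_pairs m. (1 + \<delta> * answer_sign \<sigma> v e) / 2) *
        (\<Prod>e\<in>alt_pairs m. if e \<in> T then h (answer_sign \<sigma> v e) else 1)"
      using p T by (subst pmf_pairwise[OF _ _ v]) (auto simp: H_def \<delta>_def prod.If_cases Int_absorb1)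
    also have "\<dots> = (\<Prod>e\<in>alt_pairs m. (if e \<in> T then C else 1) * (1 / 2) * (1 + ?y e * answer_sign \<sigma> v e))"
      unfolding prod.distrib[symmetric]
    proof (intro prod.cong refl)
      fix e show "(1 + \<delta> * answer_sign \<sigma> v e) / 2 * (if e \<in> T then h (answer_sign \<sigma> v e) else 1) =
          (if e \<in> T then C else 1) * (1 / 2) * (1 + ?y e * answer_sign \<sigma> v e)"
        using hC[OF sign[of v e]] by (simp add: \<delta>_def)
    qed
    also have "\<dots> = C ^ card T / 2 ^ card (alt_pairs m) * (\<Prod>e\<in>alt_pairs m. 1 + ?y e * answer_sign \<sigma> v e)"
      using T by (simp add: prod.distrib prod.If_cases Int_absorb1 power_divide prod_dividef)
    finally show ?thesis .
  qed
  have Zeq: "Z = 1 / 2 ^ card (alt_pairs m) * weight_sum m \<sigma> (\<lambda>_. \<delta>)"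
  proof -
    have "Z = (\<Sum>v\<in>ranking_answers m. 1 / 2 ^ card (alt_pairs m) *
        (\<Prod>e\<in>alt_pairs m. 1 + \<delta> * answer_sign \<sigma> v e))"
      unfolding Z_def using p
      by (simp add: measure_measure_pmf_finite pmf_pairwise \<delta>_def prod_dividef)
    also have "\<dots> = 1 / 2 ^ card (alt_pairs m) * weight_sum m \<sigma> (\<lambda>(a, b). \<delta>)"
      unfolding sum_distrib_left[symmetric] sum_ranking_answers[OF \<sigma>, of "\<lambda>_. \<delta>"] ..
    finally show ?thesis by (simp add: case_prod_unfold)
  qed
  have "(\<Sum>v\<in>ranking_answers m. pmf (pairwise_pmf m p \<sigma>) v * H v) =
      C ^ card T / 2 ^ card (alt_pairs m) *
      weight_sum m \<sigma> (\<lambda>(a, b). ?y (if a < b then (a, b) else (b, a)))"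
    unfolding sum_ranking_answers[OF \<sigma>, of ?y, symmetric] sum_distrib_left
    by (intro sum.cong fac refl)
  also have "\<dots> \<le> C ^ card T / 2 ^ card (alt_pairs m) * weight_sum m \<sigma> (\<lambda>_. \<delta>)"
    using assms permutes_inj[OF \<sigma>]
    by (intro mult_left_mono weight_sum_le_const) (auto simp: \<delta>_def)
  also have "\<dots> = C ^ card T * Z" by (simp add: Zeq)
  finally have le: "(\<Sum>v\<in>ranking_answers m. pmf (pairwise_pmf m p \<sigma>) v * H v) \<le> C ^ card T * Z" .
  have "(\<integral>\<^sup>+v. (\<Prod>e\<in>T. ennreal (h (answer_sign \<sigma> v e))) \<partial>mallows_pmf m p \<sigma>) =
      (\<integral>\<^sup>+v. ennreal (H v) \<partial>mallows_pmf m p \<sigma>)"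
    using h0 by (simp add: H_def prod_ennreal)
  also have "\<dots> = (\<Sum>v\<in>ranking_answers m. ennreal (H v) * pmf (mallows_pmf m p \<sigma>) v)"
    using ne by (intro nn_integral_measure_pmf_support) (auto simp: mallows_pmf_def)
  \<comment> \<open>Conditioning on rankings divides by \<open>Z\<close>, which cancels the
    \<open>Z\<close> in \<open>le\<close>.\<close>
  also have "\<dots> = (\<Sum>v\<in>ranking_answers m. ennreal (pmf (pairwise_pmf m p \<sigma>) v * H v / Z))"
    using ne H0 by (intro sum.cong) (auto simp: mallows_pmf_def pmf_cond Z_def ennreal_mult'[symmetric] mult.commute)
  also have "\<dots> = ennreal ((\<Sum>v\<in>ranking_answers m. pmf (pairwise_pmf m p \<sigma>) v * H v) / Z)"
    using H0 Zpos by (simp add: sum_ennreal sum_divide_distrib)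
  also have "\<dots> \<le> ennreal (C ^ card T)"
    using le Zpos by (intro ennreal_leI) (simp add: divide_le_eq)
  finally show ?thesis .
qed

section \<open>Laplace noise\<close>

definition laplace_measure :: "real \<Rightarrow> real measure" where
  "laplace_measure b = density lborel (\<lambda>x. ennreal (laplace_density b x))"

lemma borel_measurable_laplace_density [measurable]: "laplace_density b \<in> borel_measurable borel"
  unfolding laplace_density_def [abs_def] by measurable

lemma sets_laplace_measure [measurable_cong, simp]: "sets (laplace_measure b) = sets borel"
  by (simp add: laplace_measure_def)

lemma space_laplace_measure [simp]: "space (laplace_measure b) = UNIV"
  by (simp add: laplace_measure_def)

lemma laplace_upper_tail:
  assumes "0 < b" "0 \<le> a"
  shows "emeasure (laplace_measure b) {a..} = ennreal (exp (- a / b) / 2)"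
proof -
  let ?F = "\<lambda>x. - (exp (- x / b) / 2)" and ?f = "\<lambda>x. exp (- x / b) / (2 * b)"
  have "emeasure (laplace_measure b) {a..} =
      (\<integral>\<^sup>+x. ennreal (?f x) * indicator {a..} x \<partial>lborel)"
    unfolding laplace_measure_def using assms
    by (subst emeasure_density) (auto intro!: nn_integral_cong simp: laplace_density_def indicator_def)
  also have "\<dots> = ennreal (0 - ?F a)"
  proof (rule nn_integral_FTC_atLeast)
    show "DERIV ?F x :> ?f x" for x
      using assms by (auto intro!: derivative_eq_intros simp: field_simps)
    have "LIM x at_top. (1 / b) * x :> at_top"
      using assms by (intro filterlim_tendsto_pos_mult_at_top[OF tendsto_const] filterlim_ident) auto
    then have "LIM x at_top. - x / b :> at_bot"
      by (simp add: filterlim_uminus_at_bot)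
    then have "((\<lambda>x. exp (- x / b)) \<longlongrightarrow> 0) at_top"
      by (rule filterlim_compose[OF exp_at_bot])
    then have "((\<lambda>x. - (exp (- x / b) / 2)) \<longlongrightarrow> - (0 / 2)) at_top"
      by (intro tendsto_intros) auto
    then show "(?F \<longlongrightarrow> 0) at_top"
      by simp
  qed (use assms in auto)
  finally show ?thesis by simp
qed

lemma laplace_lower_tail:
  assumes "0 < b" "0 \<le> a"
  shows "emeasure (laplace_measure b) {..<- a} = ennreal (exp (- a / b) / 2)"
proof -
  have "emeasure (laplace_measure b) {..<- a} =
      (\<integral>\<^sup>+x. ennreal (laplace_density b x) * indicator {..<- a} x \<partial>lborel)"
    unfolding laplace_measure_def by (subst emeasure_density) auto
  also have "\<dots> = (\<integral>\<^sup>+x. ennreal (laplace_density b (0 + - 1 * x)) * indicator {..<- a} (0 + - 1 * x) \<partial>lborel)"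
    by (subst nn_integral_real_affine[where c = "- 1" and t = 0]) auto
  also have "\<dots> = (\<integral>\<^sup>+x. ennreal (laplace_density b x) * indicator {a..} x \<partial>lborel)"
  proof (rule nn_integral_cong_AE)
    \<comment> \<open>Reflection turns the strict bound into \<open>a < x\<close>, which differs
      from \<open>{a..}\<close> only in the null set \<open>{a}\<close>.\<close>
    show "AE x in lborel. ennreal (laplace_density b (0 + - 1 * x)) * indicator {..<- a} (0 + - 1 * x) =
        ennreal (laplace_density b x) * indicator {a..} x"
      using AE_lborel_singleton[of a]
      by eventually_elim (auto simp: laplace_density_def indicator_def)
  qed
  also have "\<dots> = emeasure (laplace_measure b) {a..}"
    unfolding laplace_measure_def by (subst emeasure_density) auto
  finally show ?thesis
    using laplace_upper_tail[OF assms] by simp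
qed

lemma prob_space_laplace_measure:
  assumes "0 < b"
  shows "prob_space (laplace_measure b)"
proof
  have "UNIV = {..<(0::real)} \<union> {0..}" by auto
  then have "emeasure (laplace_measure b) UNIV =
      emeasure (laplace_measure b) {..<0} + emeasure (laplace_measure b) {0..}"
    by (subst plus_emeasure) auto
  also have "\<dots> = ennreal (1 / 2) + ennreal (1 / 2)"
    using laplace_lower_tail[OF assms, of 0] laplace_upper_tail[OF assms, of 0] by simp
  also have "\<dots> = 1" by (subst ennreal_plus[symmetric]) auto
  finally show "emeasure (laplace_measure b) (space (laplace_measure b)) = 1" by simp
qed

text \<open>The threshold \<open>1 / 2\<close> is equally far from the answers \<open>0\<close> and
  \<open>1\<close>, so in both cases the noise flips the answer with probability
  \<open>exp (- (1 / (2 * b))) / 2 = (1 - g) / 2\<close>. Here \<open>c\<close> is the true answer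
  and \<open>r\<close> the one given by the ground truth.\<close>

lemma nn_integral_laplace_report:
  assumes "0 < b" "0 \<le> u" "0 \<le> w"
  defines "g \<equiv> 1 - exp (- (1 / (2 * b)))"
  shows "(\<integral>\<^sup>+x. ennreal (if (of_bool c + x \<ge> 1 / 2) = r then u else w) \<partial>laplace_measure b) =
    ennreal (if c = r then (1 + g) / 2 * u + (1 - g) / 2 * w else (1 - g) / 2 * u + (1 + g) / 2 * w)"
proof -
  interpret prob_space "laplace_measure b"
    using assms by (intro prob_space_laplace_measure)
  have up: "prob {1 / 2..} = (1 - g) / 2" and lo: "prob {..<- (1 / 2)} = (1 - g) / 2"
    using laplace_upper_tail[OF assms(1), of "1 / 2"] laplace_lower_tail[OF assms(1), of "1 / 2"]
    by (auto simp: measure_def g_def)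
  have up': "prob {..<1 / 2} = (1 + g) / 2"
  proof -
    have "{..<1 / 2} = space (laplace_measure b) - {1 / 2..}" by auto
    then show ?thesis using prob_compl[of "{1 / 2..}"] up by (simp add: field_simps)
  qed
  have lo': "prob {- (1 / 2)..} = (1 + g) / 2"
  proof -
    have "{- (1 / 2)..} = space (laplace_measure b) - {..<- (1 / 2)}" by auto
    then show ?thesis using prob_compl[of "{..<- (1 / 2)}"] lo by (simp add: field_simps)
  qed
  define A where "A = {x::real. (of_bool c + x \<ge> 1 / 2) = r}"
  have [measurable]: "A \<in> sets borel" unfolding A_def by measurable
  have "(\<integral>\<^sup>+x. ennreal (if (of_bool c + x \<ge> 1 / 2) = r then u else w) \<partial>laplace_measure b) =
     (\<integral>\<^sup>+x. ennreal u * indicator A x + ennreal w * indicator (- A) x \<partial>laplace_measure b)"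
    by (intro nn_integral_cong) (auto simp: A_def indicator_def)
  also have "\<dots> = ennreal u * emeasure (laplace_measure b) A + ennreal w * emeasure (laplace_measure b) (- A)"
    by (subst nn_integral_add) (auto simp: nn_integral_cmult)
  also have "\<dots> = ennreal (u * prob A + w * prob (- A))"
    using assms by (simp add: emeasure_eq_measure ennreal_mult ennreal_plus)
  also have "prob A = (if c = r then (1 + g) / 2 else (1 - g) / 2)"
  proof -
    have "A = (if r then if c then {- (1 / 2)..} else {1 / 2..} else if c then {..<- (1 / 2)} else {..<1 / 2})"
      by (auto simp: A_def)
    then show ?thesis using up lo up' lo' by auto
  qed
  moreover have "prob (- A) = 1 - prob A"
    using prob_compl[of A] by (simp add: Compl_eq_Diff_UNIV)
  ultimately show ?thesis
    by (auto simp: field_simps)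
qed

section \<open>Wrong pairs\<close>

definition report_sign :: "(nat \<Rightarrow> nat) \<Rightarrow> outcome \<Rightarrow> nat \<Rightarrow> nat \<times> nat \<Rightarrow> real" where
  "report_sign \<sigma> \<omega> i e = (if report \<omega> i e \<ge> 1 / 2 \<longleftrightarrow> \<sigma> (fst e) < \<sigma> (snd e) then 1 else - 1)"

text \<open>The sum is \<open>cmp_hat\<close> multiplied by the sign of the ground truth. The bound
  is not strict because a tie counts as an error.\<close>

definition wrong_pairs :: "nat \<Rightarrow> nat \<Rightarrow> (nat \<Rightarrow> nat) \<Rightarrow> outcome \<Rightarrow> (nat \<times> nat) set" where
  "wrong_pairs m n \<sigma> \<omega> =
     {e \<in> alt_pairs m. (\<Sum>i=1..n. if queried \<omega> i e then report_sign \<sigma> \<omega> i e else 0) \<le> 0}"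

lemma wrong_pairs_subset: "wrong_pairs m n \<sigma> \<omega> \<subseteq> alt_pairs m"
  by (auto simp: wrong_pairs_def)

lemma finite_wrong_pairs [simp]: "finite (wrong_pairs m n \<sigma> \<omega>)"
  using wrong_pairs_subset finite_alt_pairs by (rule finite_subset)

lemma cmp_error_eq_card: "cmp_error m n \<sigma> \<omega> = card (wrong_pairs m n \<sigma> \<omega>)"
proof -
  have eq: "real_of_int (cmp_hat n \<omega> e) * (if \<sigma> (fst e) < \<sigma> (snd e) then 1 else - 1) =
      (\<Sum>i=1..n. if queried \<omega> i e then report_sign \<sigma> \<omega> i e else 0)" for e
  proof -
    have "real (card {i\<in>{1..n}. queried \<omega> i e \<and> report \<omega> i e \<ge> 1 / 2}) =
        (\<Sum>i=1..n. if queried \<omega> i e \<and> report \<omega> i e \<ge> 1 / 2 then 1 else 0)"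
      by (simp add: sum.If_cases Int_def)
    moreover have "real (card {i\<in>{1..n}. queried \<omega> i e \<and> report \<omega> i e < 1 / 2}) =
        (\<Sum>i=1..n. if queried \<omega> i e \<and> report \<omega> i e < 1 / 2 then 1 else 0)"
      by (simp add: sum.If_cases Int_def)
    ultimately show ?thesis
      unfolding cmp_hat_def
      by (auto simp: sum_distrib_right sum_subtractf[symmetric] report_sign_def intro!: sum.cong)
  qed
  have "(sgn (cmp_hat n \<omega> e) \<noteq> (if \<sigma> (fst e) < \<sigma> (snd e) then 1 else - 1)) \<longleftrightarrow>
      real_of_int (cmp_hat n \<omega> e) * (if \<sigma> (fst e) < \<sigma> (snd e) then 1 else - 1) \<le> 0" for e
    by (auto simp: sgn_if)
  then have "{(j, l) \<in> alt_pairs m. sgn (cmp_hat n \<omega> (j, l)) \<noteq> (if \<sigma> j < \<sigma> l then 1 else - 1)} =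
      wrong_pairs m n \<sigma> \<omega>"
    unfolding wrong_pairs_def eq by fastforce
  then show ?thesis by (simp add: cmp_error_def)
qed

section \<open>The probability space and measurability of the wrong pairs\<close>

lemma ldp_space_eq:
  "ldp_space m n K \<epsilon> Q P =
     measure_pmf (pair_pmf Q (Pi_pmf {1..n} (\<lambda>_. False) (\<lambda>_. P))) \<Otimes>\<^sub>M
     (\<Pi>\<^sub>M x \<in> {1..n} \<times> alt_pairs m. laplace_measure (1 / (\<epsilon> / real K)))"
  by (simp add: ldp_space_def laplace_measure_def)

lemma prob_space_ldp_space:
  assumes "0 < \<epsilon>" "1 \<le> K"
  shows "prob_space (ldp_space m n K \<epsilon> Q P)"
  unfolding ldp_space_eq using assms
  by (intro prob_space_pair prob_space_PiM prob_space_measure_pmf prob_space_laplace_measure) auto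

lemma borel_measurable_report [measurable]:
  assumes "i \<in> {1..n}" "e \<in> alt_pairs m"
  shows "(\<lambda>\<omega>. report \<omega> i e) \<in> borel_measurable (ldp_space m n K \<epsilon> Q P)"
proof -
  have [measurable]: "(\<lambda>\<omega>. snd \<omega> (i, e)) \<in> borel_measurable (ldp_space m n K \<epsilon> Q P)"
    unfolding ldp_space_eq by (measurable; use assms in simp)
  have [measurable]: "(\<lambda>\<omega>. of_bool (snd (fst \<omega>) i e) :: real) \<in> borel_measurable (ldp_space m n K \<epsilon> Q P)"
    unfolding ldp_space_eq by (intro measurable_compose[OF measurable_fst]) simp
  have "(\<lambda>\<omega>. report \<omega> i e) = (\<lambda>\<omega>. of_bool (snd (fst \<omega>) i e) + snd \<omega> (i, e))"
    by (auto simp: fun_eq_iff)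
  then show ?thesis by simp
qed

lemma measurable_queried [measurable]:
  "Measurable.pred (ldp_space m n K \<epsilon> Q P) (\<lambda>\<omega>. queried \<omega> i e)"
proof -
  have "Measurable.pred (ldp_space m n K \<epsilon> Q P) (\<lambda>\<omega>. e \<in> fst (fst \<omega>) i)"
    unfolding ldp_space_eq by (intro measurable_compose[OF measurable_fst]) simp
  moreover have "(\<lambda>\<omega>. queried \<omega> i e) = (\<lambda>\<omega>. e \<in> fst (fst \<omega>) i)"
    by (auto simp: fun_eq_iff)
  ultimately show ?thesis by simp
qed

lemma pred_wrong_pairs [measurable]:
  "Measurable.pred (ldp_space m n K \<epsilon> Q P) (\<lambda>\<omega>. e \<in> wrong_pairs m n \<sigma> \<omega>)"
proof (cases "e \<in> alt_pairs m")
  case True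
  have "(\<lambda>\<omega>. report_sign \<sigma> \<omega> i e) \<in> borel_measurable (ldp_space m n K \<epsilon> Q P)"
    if "i \<in> {1..n}" for i
    unfolding report_sign_def using borel_measurable_report[OF that True] by measurable
  then have "(\<lambda>\<omega>. \<Sum>i=1..n. if queried \<omega> i e then report_sign \<sigma> \<omega> i e else 0)
      \<in> borel_measurable (ldp_space m n K \<epsilon> Q P)"
    by (intro borel_measurable_sum measurable_If) auto
  then show ?thesis
    using True by (simp add: wrong_pairs_def)
qed (simp add: wrong_pairs_def)

lemma measurable_wrong_pairs_superset [measurable]:
  assumes "finite T"
  shows "Measurable.pred (ldp_space m n K \<epsilon> Q P) (\<lambda>\<omega>. T \<subseteq> wrong_pairs m n \<sigma> \<omega>)"
  unfolding subset_eq using assms by measurable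

section \<open>Chernoff bound for a set of pairs and the resulting tail bound\<close>

lemma power_card_eq_sum_Pow:
  fixes c :: "'a :: comm_ring_1"
  assumes "finite A"
  shows "(1 + c) ^ card A = (\<Sum>T\<in>Pow A. c ^ card T)"
  using prod_add[OF assms, of "\<lambda>_. c" "\<lambda>_. 1"] by (simp add: add.commute)

text \<open>For a fixed assignment and fixed answers the noise values are independent, so
  integrating them out replaces each factor by its mean, a function \<open>h\<close> of the sign of
  the answer alone.\<close>

lemma nn_integral_noise_product:
  fixes A :: "nat \<Rightarrow> (nat \<times> nat) set" and L :: "nat \<Rightarrow> nat \<times> nat \<Rightarrow> bool"
  assumes b: "0 < b" and u: "0 \<le> u" "0 \<le> w" and T: "T \<subseteq> alt_pairs m"
  defines "g \<equiv> 1 - exp (- (1 / (2 * b)))"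
  defines "h \<equiv> \<lambda>s. (1 + g * s) / 2 * u + (1 - g * s) / 2 * w"
  shows "(\<integral>\<^sup>+X. (\<Prod>i\<in>{1..n}. \<Prod>e\<in>T \<inter> A i.
             ennreal (if report_sign \<sigma> ((A, L), X) i e = 1 then u else w))
           \<partial>(\<Pi>\<^sub>M x \<in> {1..n} \<times> alt_pairs m. laplace_measure b)) =
         (\<Prod>i\<in>{1..n}. \<Prod>e\<in>T \<inter> A i. ennreal (h (answer_sign \<sigma> (L i) e)))"
proof -
  interpret prob_space "laplace_measure b" using b by (rule prob_space_laplace_measure)
  interpret product_sigma_finite "\<lambda>_. laplace_measure b" by standard
  let ?I = "{1..n} \<times> alt_pairs m"
  \<comment> \<open>Padding with \<open>1\<close> makes the product run over all noise coordinates,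
    as the product measure requires.\<close>
  have split: "(\<Prod>i\<in>{1..n}. \<Prod>e\<in>T \<inter> A i. F i e) =
      (\<Prod>x\<in>?I. if snd x \<in> T \<inter> A (fst x) then F (fst x) (snd x) else 1)" for F :: "nat \<Rightarrow> nat \<times> nat \<Rightarrow> ennreal"
  proof -
    have "(\<Prod>e\<in>T \<inter> A i. F i e) = (\<Prod>e\<in>alt_pairs m. if e \<in> T \<inter> A i then F i e else 1)" for i
    proof -
      have "alt_pairs m \<inter> {e. e \<in> T \<inter> A i} = T \<inter> A i" using T by auto
      then show ?thesis by (subst prod.If_cases) auto
    qed
    then show ?thesis
      by (simp only: prod.cartesian_product) (simp add: case_prod_unfold)
  qed
  define \<phi> where "\<phi> x z = (if snd x \<in> T \<inter> A (fst x) then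
      ennreal (if (of_bool (L (fst x) (snd x)) + z \<ge> 1 / 2) = (\<sigma> (fst (snd x)) < \<sigma> (snd (snd x)))
        then u else w) else 1)" for x :: "nat \<times> nat \<times> nat" and z :: real
  have "(\<integral>\<^sup>+X. (\<Prod>i\<in>{1..n}. \<Prod>e\<in>T \<inter> A i.
             ennreal (if report_sign \<sigma> ((A, L), X) i e = 1 then u else w))
           \<partial>(\<Pi>\<^sub>M x \<in> ?I. laplace_measure b)) =
        (\<integral>\<^sup>+X. (\<Prod>x\<in>?I. \<phi> x (X x)) \<partial>(\<Pi>\<^sub>M x \<in> ?I. laplace_measure b))"
    unfolding split \<phi>_def
    by (intro nn_integral_cong prod.cong) (auto simp: report_sign_def)
  also have "\<dots> = (\<Prod>x\<in>?I. \<integral>\<^sup>+z. \<phi> x z \<partial>laplace_measure b)"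
    by (rule product_nn_integral_prod) (auto simp: \<phi>_def)
  also have "\<dots> = (\<Prod>x\<in>?I. if snd x \<in> T \<inter> A (fst x) then
      ennreal (h (answer_sign \<sigma> (L (fst x)) (snd x))) else 1)"
  proof (intro prod.cong refl)
    fix x :: "nat \<times> nat \<times> nat"
    show "(\<integral>\<^sup>+z. \<phi> x z \<partial>laplace_measure b) = (if snd x \<in> T \<inter> A (fst x) then
      ennreal (h (answer_sign \<sigma> (L (fst x)) (snd x))) else 1)"
    proof (cases "snd x \<in> T \<inter> A (fst x)")
      case True
      then show ?thesis
        using nn_integral_laplace_report[OF b u, of "L (fst x) (snd x)" "\<sigma> (fst (snd x)) < \<sigma> (snd (snd x))"]
        by (simp add: \<phi>_def h_def g_def answer_sign_def split del: if_split) auto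
    next
      case False
      then have "\<phi> x = (\<lambda>_. 1)" by (auto simp: \<phi>_def)
      then show ?thesis using False emeasure_space_1 by auto
    qed
  qed
  also have "\<dots> = (\<Prod>i\<in>{1..n}. \<Prod>e\<in>T \<inter> A i. ennreal (h (answer_sign \<sigma> (L i) e)))"
    unfolding split ..
  finally show ?thesis .
qed

text \<open>Exponential Markov inequality for all pairs of \<open>T\<close> at once. Integrating out
  the noise and then the independent agents leaves a factor \<open>C ^ card (T \<inter> A i)\<close>
  for each agent; counting the queries by pairs gives the exponent.\<close>

lemma wrong_pairs_prob_le:
  assumes \<epsilon>: "0 < \<epsilon>" "1 \<le> K" and p: "1 / 2 \<le> p" "p \<le> 1"
    and \<sigma>: "\<sigma> permutes {1..m}"
    and P: "P = pairwise_pmf m p \<sigma> \<or> P = mallows_pmf m p \<sigma>"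
    and Q: "set_pmf Q \<subseteq> query_assignments m n K"
    and T: "T \<subseteq> alt_pairs m"
  defines "t \<equiv> (2 * p - 1) * (1 - exp (- (\<epsilon> / (2 * real K))))"
  shows "emeasure (ldp_space m n K \<epsilon> Q P)
      {\<omega> \<in> space (ldp_space m n K \<epsilon> Q P). T \<subseteq> wrong_pairs m n \<sigma> \<omega>} \<le>
    ennreal (exp (- (t\<^sup>2 / 2 * (real n * real K / real (m choose 2)))) ^ card T)"
proof -
  define b where "b = 1 / (\<epsilon> / real K)"
  define g where "g = 1 - exp (- (1 / (2 * b)))"
  define \<delta> where "\<delta> = 2 * p - 1"
  \<comment> \<open>\<open>u\<close> and \<open>w\<close> are \<open>exp (- \<lambda>)\<close> and \<open>exp \<lambda>\<close> for the optimal Chernoff parameter \<open>tanh \<lambda> = t\<close>\<close>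
  define C where "C = sqrt (1 - t\<^sup>2)"
  define u where "u = (1 - t) / C"
  define w where "w = (1 + t) / C"
  define h where "h s = (1 + g * s) / 2 * u + (1 - g * s) / 2 * w" for s
  \<comment> \<open>This value is forced by \<open>hC\<close>: since \<open>s\<close> is a sign and
    \<open>t = \<delta> * g\<close>, the product \<open>(1 + \<delta> * s) * (1 - g * s * t)\<close>
    equals \<open>1 - t\<^sup>2 + \<delta> * (1 - g\<^sup>2) * s\<close>.\<close>
  define \<gamma> where "\<gamma> = \<delta> * (1 - g\<^sup>2) / (1 - t\<^sup>2)"
  have b: "0 < b" using \<epsilon> by (simp add: b_def)
  have t: "t = \<delta> * g" by (simp add: t_def \<delta>_def g_def b_def)
  have g: "0 \<le> g" "g < 1" using b by (auto simp: g_def)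
  have \<delta>: "0 \<le> \<delta>" "\<delta> \<le> 1" using p by (auto simp: \<delta>_def)
  have t01: "0 \<le> t" "t \<le> g" using g \<delta> by (auto simp: t mult_left_le_one_le)
  then have t1: "t < 1" using g by simp
  have t2: "t\<^sup>2 < 1" using t01 t1 by (simp add: abs_square_less_1)
  have C: "0 < C" "C\<^sup>2 = 1 - t\<^sup>2" "C \<le> 1" using t2 by (auto simp: C_def)
  have uw: "0 \<le> u" "0 \<le> w" "u * w = 1" "1 \<le> w" "0 < u"
    using C t01 t1 by (auto simp: u_def w_def field_simps power2_eq_square)
  have h_eq: "h s = (1 - g * s * t) / C" for s
    using C by (simp add: h_def u_def w_def field_simps)
  have h0: "0 \<le> h 1" "0 \<le> h (- 1)"
    using g C t01 t1 by (auto simp: h_eq intro!: divide_nonneg_nonneg mult_le_one)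
  have hC: "(1 + \<delta> * s) * h s = C * (1 + \<gamma> * s)" if "s \<in> {1, - 1}" for s
  proof -
    have "(1 + \<delta> * s) * (1 - g * s * t) = 1 - t\<^sup>2 + \<delta> * (1 - g\<^sup>2) * s"
      using that by (auto simp: t algebra_simps power2_eq_square)
    also have "\<dots> = C\<^sup>2 * (1 + \<gamma> * s)"
      using t2 by (simp add: C(2) \<gamma>_def field_simps)
    finally have "(1 + \<delta> * s) * h s = C\<^sup>2 * (1 + \<gamma> * s) / C"
      by (simp add: h_eq)
    then show ?thesis
      using C(1) by (simp add: power2_eq_square)
  qed
  have g2: "t\<^sup>2 \<le> g\<^sup>2" "g\<^sup>2 < 1"
    using t01 g by (auto simp: power_mono abs_square_less_1)
  \<comment> \<open>\<open>\<gamma> \<le> \<delta>\<close> because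
    \<open>t\<^sup>2 \<le> g\<^sup>2\<close>; it is what the Mallows case requires.\<close>
  have \<gamma>: "0 \<le> \<gamma>" "\<gamma> \<le> \<delta>"
    using \<delta> g2 t2 by (auto simp: \<gamma>_def divide_le_eq intro!: divide_nonneg_nonneg mult_left_mono)
  \<comment> \<open>Adding \<open>hC\<close> for the two signs cancels
    \<open>\<gamma>\<close>.\<close>
  have C_avg: "p * h 1 + (1 - p) * h (- 1) = C"
    using hC[of 1] hC[of "- 1"] by (simp add: \<delta>_def algebra_simps)
  have P_bound: "(\<integral>\<^sup>+v. (\<Prod>e\<in>T'. ennreal (h (answer_sign \<sigma> v e))) \<partial>P) \<le> ennreal (C ^ card T')"
    if "T' \<subseteq> alt_pairs m" for T'
    using P
  proof
    assume "P = pairwise_pmf m p \<sigma>"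
    then show ?thesis
      using pairwise_product_bound[where h = h, OF _ _ that h0 C_avg] p by simp
  next
    assume "P = mallows_pmf m p \<sigma>"
    then show ?thesis
      using mallows_product_bound[where h = h and \<gamma> = \<gamma>, OF p \<sigma> that h0 _ \<gamma>(1)] C(1) \<gamma>(2) hC
      by (simp add: \<delta>_def)
  qed
  define N where "N = (\<Pi>\<^sub>M x \<in> {1..n} \<times> alt_pairs m. laplace_measure b)"
  define M1 where "M1 = pair_pmf Q (Pi_pmf {1..n} (\<lambda>_. False) (\<lambda>_. P))"
  define B where "B = {\<omega> \<in> space (ldp_space m n K \<epsilon> Q P). T \<subseteq> wrong_pairs m n \<sigma> \<omega>}"
  have M_eq: "ldp_space m n K \<epsilon> Q P = measure_pmf M1 \<Otimes>\<^sub>M N"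
    by (simp add: ldp_space_eq M1_def N_def b_def)
  interpret N: prob_space N
    unfolding N_def using b by (intro prob_space_PiM prob_space_laplace_measure)
  have finT: "finite T" using T finite_alt_pairs by (rule finite_subset)
  have B: "B \<in> sets (ldp_space m n K \<epsilon> Q P)"
    unfolding B_def using measurable_wrong_pairs_superset[OF finT] by measurable
  \<comment> \<open>Since \<open>u = 1 / w\<close>, the factors of each pair multiply to
    \<open>w\<close> raised to minus its sum of report signs. On \<open>B\<close> these sums are at
    most \<open>0\<close>, and \<open>1 \<le> w\<close>.\<close>
  have pointwise: "indicator B ((A, L), X) \<le>
      (\<Prod>i\<in>{1..n}. \<Prod>e\<in>T \<inter> A i. ennreal (if report_sign \<sigma> ((A, L), X) i e = 1 then u else w))" for A L X
  proof (cases "((A, L), X) \<in> B")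
    case True
    define Y where "Y i e = report_sign \<sigma> ((A, L), X) i e" for i e
    have Y: "Y i e \<in> {1, - 1}" for i e by (simp add: Y_def report_sign_def)
    have val: "(if Y i e = 1 then u else w) = w powr (- Y i e)" for i e
      using Y[of i e] uw by (auto simp: powr_minus field_simps)
    have "(\<Prod>i\<in>{1..n}. \<Prod>e\<in>T \<inter> A i. if Y i e = 1 then u else w) =
        (\<Prod>i\<in>{1..n}. \<Prod>e\<in>T. w powr (if e \<in> A i then - Y i e else 0))"
      using uw finT by (simp add: val if_distrib[of "\<lambda>x. w powr x"] prod.inter_restrict cong: if_cong)
    also have "\<dots> = (\<Prod>e\<in>T. \<Prod>i\<in>{1..n}. w powr (if e \<in> A i then - Y i e else 0))"
      by (rule prod.swap)
    also have "\<dots> = (\<Prod>e\<in>T. w powr (\<Sum>i\<in>{1..n}. if e \<in> A i then - Y i e else 0))"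
      using uw by (simp add: powr_sum)
    also have "\<dots> \<ge> 1"
    proof (rule prod_ge_1)
      fix e assume "e \<in> T"
      then have "(\<Sum>i=1..n. if e \<in> A i then Y i e else 0) \<le> 0"
        using True unfolding Y_def by (auto simp: B_def wrong_pairs_def)
      moreover have "(\<Sum>i\<in>{1..n}. if e \<in> A i then - Y i e else 0) =
          - (\<Sum>i=1..n. if e \<in> A i then Y i e else 0)"
        unfolding sum_negf[symmetric] by (intro sum.cong) auto
      ultimately have "0 \<le> (\<Sum>i\<in>{1..n}. if e \<in> A i then - Y i e else 0)"
        by simp
      then show "1 \<le> w powr (\<Sum>i\<in>{1..n}. if e \<in> A i then - Y i e else 0)"
        using uw by (simp add: ge_one_powr_ge_zero)
    qed
    finally have "1 \<le> (\<Prod>i\<in>{1..n}. \<Prod>e\<in>T \<inter> A i. if Y i e = 1 then u else w)" .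
    then have "ennreal 1 \<le> ennreal (\<Prod>i\<in>{1..n}. \<Prod>e\<in>T \<inter> A i. if Y i e = 1 then u else w)"
      by (rule ennreal_leI)
    also have "\<dots> = (\<Prod>i\<in>{1..n}. \<Prod>e\<in>T \<inter> A i. ennreal (if Y i e = 1 then u else w))"
      using uw by (simp add: prod_ennreal prod_nonneg)
    finally show ?thesis using True by (simp add: Y_def)
  qed simp
  have "emeasure (ldp_space m n K \<epsilon> Q P) B = (\<integral>\<^sup>+\<omega>. indicator B \<omega> \<partial>(measure_pmf M1 \<Otimes>\<^sub>M N))"
    using B by (simp add: M_eq)
  also have "\<dots> = (\<integral>\<^sup>+x. \<integral>\<^sup>+X. indicator B (x, X) \<partial>N \<partial>M1)"
    using B by (intro N.nn_integral_fst[symmetric]) (simp add: M_eq)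
  also have "\<dots> \<le> (\<integral>\<^sup>+x. \<integral>\<^sup>+X. (\<Prod>i\<in>{1..n}. \<Prod>e\<in>T \<inter> fst x i.
      ennreal (if report_sign \<sigma> (x, X) i e = 1 then u else w)) \<partial>N \<partial>M1)"
    by (intro nn_integral_mono, use pointwise[of "fst x" "snd x" for x] in simp)
  also have "\<dots> = (\<integral>\<^sup>+x. (\<Prod>i\<in>{1..n}. \<Prod>e\<in>T \<inter> fst x i. ennreal (h (answer_sign \<sigma> (snd x i) e))) \<partial>M1)"
    using nn_integral_noise_product[OF b uw(1,2) T]
    by (intro nn_integral_cong) (auto simp: N_def h_def g_def)
  also have "\<dots> = (\<integral>\<^sup>+A. \<integral>\<^sup>+L. (\<Prod>i\<in>{1..n}. \<Prod>e\<in>T \<inter> A i. ennreal (h (answer_sign \<sigma> (L i) e)))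
      \<partial>Pi_pmf {1..n} (\<lambda>_. False) (\<lambda>_. P) \<partial>Q)"
    by (simp add: M1_def nn_integral_pair_pmf')
  also have "\<dots> = (\<integral>\<^sup>+A. (\<Prod>i\<in>{1..n}. \<integral>\<^sup>+v. (\<Prod>e\<in>T \<inter> A i. ennreal (h (answer_sign \<sigma> v e))) \<partial>P) \<partial>Q)"
    by (intro nn_integral_cong nn_integral_prod_Pi_pmf[where f = "\<lambda>i v. \<Prod>e\<in>T \<inter> _ i. ennreal (h (answer_sign \<sigma> v e))"]) simp
  also have "\<dots> \<le> (\<integral>\<^sup>+A. ennreal (exp (- (t\<^sup>2 / 2 * (real n * real K / real (m choose 2)))) ^ card T) \<partial>Q)"
  \<comment> \<open>The bound holds for every admissible assignment, hence for the average over
    \<open>Q\<close>.\<close>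
  proof (intro nn_integral_mono_AE AE_pmfI)
    fix A assume "A \<in> set_pmf Q"
    then have A: "A \<in> query_assignments m n K" using Q by auto
    have "(\<Prod>i\<in>{1..n}. \<integral>\<^sup>+v. (\<Prod>e\<in>T \<inter> A i. ennreal (h (answer_sign \<sigma> v e))) \<partial>P) \<le>
        (\<Prod>i\<in>{1..n}. ennreal (C ^ card (T \<inter> A i)))"
      using T by (intro prod_mono_ennreal P_bound) auto
    also have "\<dots> = ennreal (C ^ (\<Sum>i\<in>{1..n}. card (T \<inter> A i)))"
      using C by (simp add: prod_ennreal power_sum)
    \<comment> \<open>Double counting of the queries with pair in \<open>T\<close>, by agents and by
      pairs.\<close>
    also have "(\<Sum>i\<in>{1..n}. card (T \<inter> A i)) = (\<Sum>e\<in>T. card {i\<in>{1..n}. e \<in> A i})"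
    proof -
      have "(\<Sum>i\<in>{1..n}. card (T \<inter> A i)) = (\<Sum>i\<in>{1..n}. \<Sum>e\<in>T. if e \<in> A i then 1 else 0)"
        using finT by (simp add: sum.If_cases)
      also have "\<dots> = (\<Sum>e\<in>T. \<Sum>i\<in>{1..n}. if e \<in> A i then 1 else 0)"
        by (rule sum.swap)
      also have "\<dots> = (\<Sum>e\<in>T. card {i\<in>{1..n}. e \<in> A i})"
        by (simp add: sum.If_cases Int_def)
      finally show ?thesis .
    qed
    also have "C ^ (\<Sum>e\<in>T. card {i\<in>{1..n}. e \<in> A i}) \<le>
        exp (- (t\<^sup>2 / 2 * (real n * real K / real (m choose 2)))) ^ card T"
    proof -
      \<comment> \<open>From
        \<open>C\<^sup>2 = 1 - t\<^sup>2 \<le> exp (- t\<^sup>2)\<close>.\<close>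
      have "C \<le> exp (- (t\<^sup>2 / 2))"
      proof (rule power2_le_imp_le)
        show "C\<^sup>2 \<le> (exp (- (t\<^sup>2 / 2)))\<^sup>2"
          using exp_ge_add_one_self[of "- t\<^sup>2"] by (simp add: C exp_double[symmetric])
      qed simp
      then have "C ^ (\<Sum>e\<in>T. card {i\<in>{1..n}. e \<in> A i}) \<le>
          exp (- (t\<^sup>2 / 2)) ^ (\<Sum>e\<in>T. card {i\<in>{1..n}. e \<in> A i})"
        using C by (intro power_mono) auto
      also have "\<dots> = exp (- (t\<^sup>2 / 2) * (\<Sum>e\<in>T. real (card {i\<in>{1..n}. e \<in> A i})))"
        by (simp add: exp_of_nat_mult[symmetric] mult.commute)
      \<comment> \<open>The balance condition of \<open>query_assignments\<close>: every pair goes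
        to the same number of agents.\<close>
      also have "(\<Sum>e\<in>T. real (card {i\<in>{1..n}. e \<in> A i})) =
          real (card T) * (real n * real K / real (m choose 2))"
        using A T by (subst sum.cong[OF refl, where h = "\<lambda>_. real n * real K / real (m choose 2)"])
          (auto simp: query_assignments_def)
      finally show ?thesis
        by (simp add: exp_of_nat_mult[symmetric] mult_ac)
    qed
    finally show "(\<Prod>i\<in>{1..n}. \<integral>\<^sup>+v. (\<Prod>e\<in>T \<inter> A i. ennreal (h (answer_sign \<sigma> v e))) \<partial>P) \<le>
        ennreal (exp (- (t\<^sup>2 / 2 * (real n * real K / real (m choose 2)))) ^ card T)"
      by (simp add: ennreal_leI)
  qed
  also have "\<dots> = ennreal (exp (- (t\<^sup>2 / 2 * (real n * real K / real (m choose 2)))) ^ card T)"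
    by simp
  finally show ?thesis by (simp add: B_def)
qed

text \<open>Markov's inequality for \<open>4 ^ card (W \<omega>)\<close>, which equals the sum of \<open>3 ^ card T\<close> over \<open>T \<subseteq> W \<omega>\<close>.\<close>

lemma card_tail_bound:
  fixes W :: "'a \<Rightarrow> 'b set" and s R :: real
  assumes "prob_space M" "finite E" "\<And>\<omega>. W \<omega> \<subseteq> E"
    and meas: "\<And>e. Measurable.pred M (\<lambda>\<omega>. e \<in> W \<omega>)"
    and bound: "\<And>T. T \<subseteq> E \<Longrightarrow> emeasure M {\<omega> \<in> space M. T \<subseteq> W \<omega>} \<le> ennreal (s ^ card T)"
    and "0 \<le> s" and R: "12 * real (card E) * s \<le> R"
  shows "measure M {\<omega> \<in> space M. real (card (W \<omega>)) < R} \<ge> 1 - 2 powr (- R)"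
proof -
  interpret prob_space M by fact
  have finW: "finite (W \<omega>)" for \<omega> using assms(2,3) by (rule finite_subset[rotated])
  have sup_meas [measurable]: "Measurable.pred M (\<lambda>\<omega>. T \<subseteq> W \<omega>)" if "T \<subseteq> E" for T
    unfolding subset_eq using finite_subset[OF that \<open>finite E\<close>] meas by measurable
  have card_eq: "real (card (W \<omega>)) = (\<Sum>e\<in>E. if e \<in> W \<omega> then 1 else 0)" for \<omega>
    using assms(2,3) by (simp add: sum.If_cases Int_absorb1)
  have [measurable]: "(\<lambda>\<omega>. real (card (W \<omega>))) \<in> borel_measurable M"
    unfolding card_eq using meas by measurable
  define B where "B = {\<omega> \<in> space M. R \<le> real (card (W \<omega>))}"
  have B [measurable]: "B \<in> sets M" unfolding B_def by measurable
  have "ennreal (4 powr R) * emeasure M B = (\<integral>\<^sup>+\<omega>. ennreal (4 powr R) * indicator B \<omega> \<partial>M)"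
    by (simp add: nn_integral_cmult)
  also have "\<dots> \<le> (\<integral>\<^sup>+\<omega>. (\<Sum>T\<in>Pow E. ennreal (3 ^ card T) * indicator {\<omega> \<in> space M. T \<subseteq> W \<omega>} \<omega>) \<partial>M)"
  proof (rule nn_integral_mono)
    fix \<omega> assume \<omega>: "\<omega> \<in> space M"
    have "ennreal (4 powr R) * indicator B \<omega> \<le> ennreal (4 powr real (card (W \<omega>)))"
      by (auto simp: B_def indicator_def intro!: ennreal_leI powr_mono)
    also have "4 powr real (card (W \<omega>)) = (\<Sum>T\<in>Pow (W \<omega>). 3 ^ card T)"
      using power_card_eq_sum_Pow[OF finW, of "3::real" \<omega>] by (simp add: powr_realpow)
    also have "ennreal \<dots> = (\<Sum>T\<in>Pow (W \<omega>). ennreal (3 ^ card T))"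
      by (subst sum_ennreal) auto
    also have "\<dots> = (\<Sum>T\<in>Pow E. ennreal (3 ^ card T) * indicator {\<omega> \<in> space M. T \<subseteq> W \<omega>} \<omega>)"
      using assms(2,3) \<omega> by (intro sum.mono_neutral_cong_left) (auto simp: indicator_def)
    finally show "ennreal (4 powr R) * indicator B \<omega> \<le>
        (\<Sum>T\<in>Pow E. ennreal (3 ^ card T) * indicator {\<omega> \<in> space M. T \<subseteq> W \<omega>} \<omega>)" .
  qed
  also have "\<dots> = (\<Sum>T\<in>Pow E. ennreal (3 ^ card T) * emeasure M {\<omega> \<in> space M. T \<subseteq> W \<omega>})"
    by (subst nn_integral_sum) (auto simp: nn_integral_cmult)
  also have "\<dots> \<le> (\<Sum>T\<in>Pow E. ennreal (3 ^ card T) * ennreal (s ^ card T))"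
    using bound by (intro sum_mono mult_left_mono) auto
  also have "\<dots> = ennreal (\<Sum>T\<in>Pow E. (3 * s) ^ card T)"
    using \<open>0 \<le> s\<close> by (simp add: ennreal_mult[symmetric] sum_ennreal power_mult_distrib)
  also have "(\<Sum>T\<in>Pow E. (3 * s) ^ card T) = (1 + 3 * s) ^ card E"
    using power_card_eq_sum_Pow[OF \<open>finite E\<close>, of "3 * s"] by simp
  finally have "4 powr R * prob B \<le> (1 + 3 * s) ^ card E"
    using \<open>0 \<le> s\<close> by (simp add: emeasure_eq_measure ennreal_mult[symmetric])
  also have "\<dots> \<le> exp (3 * s) ^ card E"
    using \<open>0 \<le> s\<close> exp_ge_add_one_self[of "3 * s"] by (intro power_mono) auto
  also have "\<dots> = exp (3 * real (card E) * s)"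
    by (simp add: exp_of_nat_mult[symmetric] mult_ac)
  \<comment> \<open>The constant \<open>12\<close> gives
    \<open>3 * real (card E) * s \<le> R / 4\<close>, and \<open>1 / 4 \<le> ln 2\<close>.\<close>
  also have "\<dots> \<le> exp (R * ln 2)"
  proof -
    have R0: "0 \<le> R" using R \<open>0 \<le> s\<close> by (meson mult_nonneg_nonneg of_nat_0_le_iff order_trans zero_le_numeral)
    have "ln (1 / 2) \<le> 1 / 2 - (1::real)" by (rule ln_le_minus_one) simp
    then have "1 / 4 \<le> ln (2::real)" by (simp add: ln_div)
    then have "R * (1 / 4) \<le> R * ln 2" using R0 by (rule mult_left_mono)
    then show ?thesis using R by simp
  qed
  also have "\<dots> = 2 powr R" by (simp add: powr_def)
  finally have "4 powr R * prob B \<le> 2 powr R" .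
  \<comment> \<open>Dividing the bound \<open>2 powr R\<close> by \<open>4 powr R\<close> leaves
    \<open>2 powr (- R)\<close>.\<close>
  moreover have "(4::real) powr R = 2 powr R * 2 powr R"
    using powr_mult[of 2 2 R] by simp
  ultimately have "2 powr R * prob B \<le> 1" by (simp add: mult.assoc)
  then have "prob B \<le> 2 powr (- R)" by (simp add: powr_minus field_simps)
  moreover have "{\<omega> \<in> space M. real (card (W \<omega>)) < R} = space M - B"
    by (auto simp: B_def)
  ultimately show ?thesis using prob_compl[OF B] by simp
qed

lemma card_alt_pairs: "card (alt_pairs m) = m choose 2"
proof (induction m)
  case 0
  have "alt_pairs 0 = {}" by (auto simp: alt_pairs_def)
  then show ?case by (simp add: numeral_2_eq_2)
next
  case (Suc m)
  have "alt_pairs (Suc m) = alt_pairs m \<union> (\<lambda>j. (j, Suc m)) ` {1..m}"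
    by (auto simp: alt_pairs_def)
  moreover have "card ((\<lambda>j. (j, Suc m)) ` {1..m}) = m"
    by (subst card_image) (auto simp: inj_on_def)
  moreover have "alt_pairs m \<inter> (\<lambda>j. (j, Suc m)) ` {1..m} = {}"
    by (auto simp: alt_pairs_def)
  ultimately have "card (alt_pairs (Suc m)) = (m choose 2) + m"
    using Suc by (simp add: card_Un_disjoint)
  then show ?case by (simp add: numeral_2_eq_2)
qed

theorem theorem3:
  fixes m n K :: nat and \<epsilon> p q \<theta> \<theta>s \<mu> :: real
    and \<sigma> :: "nat \<Rightarrow> nat"
    and P :: "(nat \<times> nat \<Rightarrow> bool) pmf"
    and Q :: "(nat \<Rightarrow> (nat \<times> nat) set) pmf"
  assumes "\<epsilon> > 0" and "K \<ge> 1"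
    and "1 / 2 \<le> p" and "p \<le> 1" and "q = 1 - p"
    and "\<theta> = 1 - q / p" and "\<theta>s = \<theta> / (2 - \<theta>)"
    and "\<sigma> permutes {1..m}"
    and "P = pairwise_pmf m p \<sigma> \<or> P = mallows_pmf m p \<sigma>"
    and "set_pmf Q \<subseteq> query_assignments m n K"
    and "\<mu> = 2 * real (m choose 2) *
           exp (- ((1 - exp (- (\<epsilon> / (2 * real K))))\<^sup>2 * real K *
                   (\<theta>s\<^sup>2 * real n / (real m * (real m - 1)))))"
  shows "measure (ldp_space m n K \<epsilon> Q P)
           {\<omega> \<in> space (ldp_space m n K \<epsilon> Q P). real (cmp_error m n \<sigma> \<omega>) < 6 * \<mu>}
         \<ge> 1 - 2 powr (- (6 * \<mu>))"
proof -
  define t where "t = (2 * p - 1) * (1 - exp (- (\<epsilon> / (2 * real K))))"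
  define s where "s = exp (- (t\<^sup>2 / 2 * (real n * real K / real (m choose 2))))"
  \<comment> \<open>\<open>\<theta>s\<close> is the bias of a single answer in the pairwise
    model.\<close>
  have \<theta>s: "\<theta>s = 2 * p - 1"
  proof -
    have "\<theta> = (2 * p - 1) / p" "2 - \<theta> = 1 / p"
      using assms(3-6) by (auto simp: field_simps)
    then show ?thesis using assms(3,7) by simp
  qed
  have choose: "real (m choose 2) = real m * (real m - 1) / 2"
  proof (cases m)
    case (Suc k)
    have "real (m choose 2) = real (m * (m - 1)) / 2"
      unfolding choose_two by (subst real_of_nat_div) (auto simp: Suc)
    then show ?thesis by (simp add: Suc algebra_simps)
  qed simp
  have \<mu>: "\<mu> = 2 * real (m choose 2) * s"
  proof -
    \<comment> \<open>With \<open>c = m * (m - 1)\<close> and \<open>c / 2 = m choose 2\<close> this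
      matches the two exponents. It also holds for \<open>c = 0\<close>, that is
      \<open>m \<le> 1\<close>, where both quotients are \<open>0\<close> by convention.\<close>
    have "a / 2 * (real n * real K / (c / 2)) = a * real K * real n / c" for a c :: real
      by simp
    then show ?thesis
      unfolding assms(11) s_def t_def \<theta>s choose
      by (simp only: power_mult_distrib) (simp add: mult_ac)
  qed
  show ?thesis
    unfolding cmp_error_eq_card
  proof (rule card_tail_bound[where E = "alt_pairs m" and s = s])
    show "prob_space (ldp_space m n K \<epsilon> Q P)"
      using assms by (intro prob_space_ldp_space)
    show "emeasure (ldp_space m n K \<epsilon> Q P)
        {\<omega> \<in> space (ldp_space m n K \<epsilon> Q P). T \<subseteq> wrong_pairs m n \<sigma> \<omega>} \<le> ennreal (s ^ card T)"
      if "T \<subseteq> alt_pairs m" for T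
      unfolding s_def t_def using assms that by (intro wrong_pairs_prob_le)
    \<comment> \<open>Equality holds: \<open>6 * \<mu>\<close> is exactly
      \<open>12 * real (m choose 2) * s\<close>.\<close>
    show "12 * real (card (alt_pairs m)) * s \<le> 6 * \<mu>"
      by (simp add: card_alt_pairs \<mu>)
  qed (simp_all add: wrong_pairs_subset pred_wrong_pairs s_def)
qed

end
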